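(* Let $HG$ be the Heawood graph and let $f:HG\to\mathbb{R}^{2}$ be a plane generic immersion. Then \[ \sum_{\gamma\in\Gamma_{6}(HG)}\mathrm{rot}(f(\gamma))\equiv\sum_{\gamma\in\Gamma_{10}(HG)}\mathrm{rot}(f(\gamma))\equiv 1\pmod 2 \] and \[ \sum_{\gamma\in\Gamma_{8}(HG)}\mathrm{rot}(f(\gamma))\equiv\sum_{\gamma\in\Gamma_{12}(HG)}\mathrm{rot}(f(\gamma))\equiv\sum_{\gamma\in\Gamma_{14}(HG)}\mathrm{rot}(f(\gamma))\equiv 0\pmod 2, \] where $\Gamma_k(HG)$ is the set of all $k$-cycles of $HG$.
   Context: The Heawood graph $HG$ has vertices $u_i,v_i$ ($i\in\mathbb{Z}/7\mathbb{Z}$) and the $21$ edges $u_iv_i$, $u_iv_{i-1}$, $v_iu_{i-2}$. A finite graph $G$ is regarded as a topological space in the usual way. A $k$-cycle of $G$ is a subgraph with $k$ edges homeomorphic to a circle. A plane generic immersion of $G$ is an immersion $f:G\to\mathbb{R}^2$ (a continuous locally injective, piecewise smooth map) whose multiple points are only finitely many transversal double points between edges, i.e. between interior points of edges (possibly of the same edge). Each cycle $\gamma$ is given an arbitrary orientation, and $\mathrm{rot}(f(\gamma))$ is the rotation number (turning number) of the oriented immersed closed plane curve $f(\gamma)$, corners at vertices being smoothed; equivalently, parametrizing $f|_\gamma$ by $c:\mathbb{R}/\mathbb{Z}\to\mathbb{R}^2$, it is the degree of $t\mapsto (c(t+\epsilon)-c(t))/\|c(t+\epsilon)-c(t)\|$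 for small $\epsilon>0$. Its parity does not depend on the orientation. *)

theory Defs
  imports
    "HOL-Complex_Analysis.Complex_Analysis"
    "HOL-Number_Theory.Cong"
    "HOL-Library.Numeral_Type"
begin

text \<open>
  The type \<open>7\<close> of \<open>HOL-Library.Numeral_Type\<close> is the ring of integers modulo 7, so the index
  arithmetic below is modulo 7.
\<close>

datatype heawood_vertex = HU "7" | HV "7"

instance heawood_vertex :: finite
proof
  have "x \<in> range HU \<union> range HV" for x :: heawood_vertex
    by (cases x) auto
  then have "(UNIV :: heawood_vertex set) = range HU \<union> range HV"
    by auto
  then show "finite (UNIV :: heawood_vertex set)"
    by (metis finite finite_Un finite_imageI)
qed

definition heawood_edges :: "heawood_vertex set set" where
  "heawood_edges =
     (\<Union>i. {{HU i, HV i}, {HU i, HV (i - 1)}, {HV i, HU (i - 2)}})"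

text \<open>
  A finite simple graph without isolated vertices is given by its set \<open>E\<close> of edges, each of them
  a two-element set of vertices.  Its underlying topological space is its realization as a
  one-dimensional simplicial complex: the vertex \<open>a\<close> is the unit vector \<open>axis a 1\<close>, and an
  edge is the segment between its two ends.
\<close>

definition realization :: "'v::finite set set \<Rightarrow> (real ^ 'v) set" where
  "realization E = (\<Union>e\<in>E. convex hull ((\<lambda>a. axis a 1) ` e))"

definition edge_path :: "'v::finite \<Rightarrow> 'v \<Rightarrow> real \<Rightarrow> real ^ 'v" where
  "edge_path a b = linepath (axis a 1) (axis b 1)"

text \<open>
  A subgraph homeomorphic to a circle has no isolated vertices, so it is determined by its edges.
\<close>

definition cycles :: "nat \<Rightarrow> 'v::finite set set \<Rightarrow> 'v set set set" where
  "cycles k E =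
     {C. C \<subseteq> E \<and> card C = k \<and> realization C homeomorphic sphere (0::complex) 1}"

text \<open>
  An oriented cycle is presented by a simple closed path running once around it; the direction of
  the path is the orientation.
\<close>

definition parametrizes :: "(real \<Rightarrow> real ^ 'v::finite) \<Rightarrow> 'v set set \<Rightarrow> bool" where
  "parametrizes p C \<longleftrightarrow>
     simple_path p \<and> pathfinish p = pathstart p \<and> path_image p = realization C"

text \<open>
  The plane is the type \<open>complex\<close>.  Piecewise smoothness is the library's \<open>valid_path\<close>
  (piecewise \<open>C\<^sup>1\<close>), required on each edge.
\<close>

definition plane_immersion :: "'v::finite set set \<Rightarrow> (real ^ 'v \<Rightarrow> complex) \<Rightarrow> bool" where
  "plane_immersion E f \<longleftrightarrow>
     continuous_on (realization E) f \<and>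
     (\<forall>x\<in>realization E. \<exists>U. open U \<and> x \<in> U \<and> inj_on f (U \<inter> realization E)) \<and>
     (\<forall>a b. {a, b} \<in> E \<longrightarrow> valid_path (f \<circ> edge_path a b))"

text \<open>
  The points \<open>x\<close> and \<open>y\<close> are interior points of (possibly equal) edges \<open>ab\<close> and \<open>cd\<close> at
  which the two image curves have linearly independent velocities.
\<close>

definition transversal_at ::
    "'v::finite set set \<Rightarrow> (real ^ 'v \<Rightarrow> complex) \<Rightarrow> real ^ 'v \<Rightarrow> real ^ 'v \<Rightarrow> bool" where
  "transversal_at E f x y \<longleftrightarrow>
     (\<exists>a b c d s t v w.
        {a, b} \<in> E \<and> {c, d} \<in> E \<and> s \<in> {0<..<1} \<and> t \<in> {0<..<1} \<and>
        x = edge_path a b s \<and> y = edge_path c d t \<and>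
        ((f \<circ> edge_path a b) has_vector_derivative v) (at s) \<and>
        ((f \<circ> edge_path c d) has_vector_derivative w) (at t) \<and>
        \<not> collinear {0, v, w})"

definition plane_generic_immersion :: "'v::finite set set \<Rightarrow> (real ^ 'v \<Rightarrow> complex) \<Rightarrow> bool" where
  "plane_generic_immersion E f \<longleftrightarrow>
     plane_immersion E f \<and>
     finite {x \<in> realization E. \<exists>y \<in> realization E. y \<noteq> x \<and> f y = f x} \<and>
     (\<forall>x\<in>realization E. \<forall>y\<in>realization E. \<forall>z\<in>realization E.
        f x = f y \<and> f y = f z \<longrightarrow> x = y \<or> y = z \<or> x = z) \<and>
     (\<forall>x\<in>realization E. \<forall>y\<in>realization E.
        x \<noteq> y \<and> f x = f y \<longrightarrow> transversal_at E f x y)"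

text \<open>
  A closed curve is given by a path \<open>c\<close> on the unit interval with \<open>c 0 = c 1\<close>; the use of \<open>frac\<close>
  extends it periodically, i.e. to the real line modulo 1.  The rotation number is the degree of
  the circle-valued secant map \<open>t \<mapsto> (c (t + \<epsilon>) - c t) / \<parallel>c (t + \<epsilon>) - c t\<parallel>\<close> for small
  \<open>\<epsilon> > 0\<close>, and the degree of a closed curve in the unit circle is its winding number
  about 0.
\<close>

definition secant_direction :: "(real \<Rightarrow> complex) \<Rightarrow> real \<Rightarrow> real \<Rightarrow> complex" where
  "secant_direction c \<epsilon> t = sgn (c (frac (t + \<epsilon>)) - c (frac t))"

definition rotation_number :: "(real \<Rightarrow> complex) \<Rightarrow> int" where
  "rotation_number c =
     (THE n. \<forall>\<^sub>F \<epsilon> in at_right 0. winding_number (secant_direction c \<epsilon>) 0 = of_int n)"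

end

theory Submission
  imports Defs
begin

text \<open>
  On the simply connected domain \<open>s < t \<le> s + \<mu>\<close> the secant \<open>c t - c s\<close> of a locally injective
  closed curve has a continuous square root, and the parity of the rotation number is the sign of
  its monodromy under \<open>(s, t) \<mapsto> (s + 1, t + 1)\<close>.  Choose such a root for every edge of the graph,
  those of the two orientations of an edge differing by the factor \<open>\<plusminus>\<i>\<close>.  Continuing
  the root around the corner \<open>a - v - b\<close> compares the roots of the two edges and gives a sign
  \<open>turn a v b\<close>, and \<open>(-1)\<^sup>r\<^sup>o\<^sup>t\<close> of a cycle is the product of the signs of its corners.  Since the
  graph is bipartite, \<open>turn b v a = - turn a v b\<close>.  In the Heawood graph every corner lies on an
  even number of \<open>k\<close>-cycles (4, 4, 20, 16, 8 for \<open>k = 6, 8, 10, 12, 14\<close>), so in the product over all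
  \<open>k\<close>-cycles the unknown signs cancel, and only the parity of the number of reversed corners
  remains; this is a finite count.
\<close>

section \<open>Cycles as subspaces of the realization\<close>

text \<open>The parametrization \<open>p\<close> of a cycle is an arbitrary continuous one, so it is
  tied to the linear parameter of an edge only by an increasing homeomorphism, which carries secants
  of fixed width to secants of varying width. This is the reason for the two-parameter domain: a
  time change that keeps small widths small maps one such domain into another, so roots found on
  edges, on corners and along the loop can be compared. Secants that straddle a vertex are nonzero
  by local injectivity, so a corner needs neither a tangent nor a smoothing. Roots are preferred to
  logarithms because their ambiguity on an edge is a sign, and signs cancel in pairs. The factor
  \<open>\<i>\<close> enters since reversing an edge negates its secants. The direction of a cycle
  is arbitrary; reversing it negates all its corner signs, which is harmless because the lengths are
  even. What remains is to match topological circles with vertex sequences: a simple closed path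
  must be shown to pass through the vertices of a cycle one after the other.\<close>

fun path_edges :: "'a list \<Rightarrow> 'a set set" where
  "path_edges (a # b # r) = insert {a, b} (path_edges (b # r))"
| "path_edges _ = {}"

definition cycle_edges :: "'a list \<Rightarrow> 'a set set" where
  "cycle_edges vs = insert {last vs, hd vs} (path_edges vs)"

lemma path_edges_conv_nth: "path_edges vs = {{vs ! i, vs ! Suc i} |i. Suc i < length vs}"
proof (induction vs rule: path_edges.induct)
  case (1 a b r)
  have "{{(a # b # r) ! i, (a # b # r) ! Suc i} |i. Suc i < length (a # b # r)} =
        insert {a, b} {{(b # r) ! i, (b # r) ! Suc i} |i. Suc i < length (b # r)}"
    (is "?L = ?R")
  proof
    show "?L \<subseteq> ?R"
    proof
      fix e assume "e \<in> ?L"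
      then obtain i where "e = {(a # b # r) ! i, (a # b # r) ! Suc i}" "Suc i < length (a # b # r)"
        by blast
      then show "e \<in> ?R" by (cases i) auto
    qed
    have "{a, b} \<in> ?L" by (intro CollectI exI[of _ 0]) auto
    moreover have "{(b # r) ! i, (b # r) ! Suc i} \<in> ?L" if "Suc i < length (b # r)" for i
      using that by (intro CollectI exI[of _ "Suc i"]) auto
    ultimately show "?R \<subseteq> ?L" by blast
  qed
  then show ?case using 1 by simp
qed auto

lemma cycle_edges_conv_nth:
  assumes "vs \<noteq> []"
  shows "cycle_edges vs = (\<lambda>i. {vs ! i, vs ! (Suc i mod length vs)}) ` {..<length vs}"
proof -
  obtain m where m: "length vs = Suc m" using assms by (cases vs) auto
  have "(\<lambda>i. {vs ! i, vs ! (Suc i mod length vs)}) ` {..<length vs} =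
        insert {vs ! m, vs ! 0} ((\<lambda>i. {vs ! i, vs ! Suc i}) ` {..<m})"
    by (simp add: m lessThan_Suc)
  also have "(\<lambda>i. {vs ! i, vs ! Suc i}) ` {..<m} = path_edges vs"
    unfolding path_edges_conv_nth m by auto
  finally show ?thesis
    using assms by (simp add: cycle_edges_def last_conv_nth hd_conv_nth m)
qed

lemma path_edges_subset_Pow: "e \<in> path_edges vs \<Longrightarrow> e \<subseteq> set vs"
  by (induction vs rule: path_edges.induct) auto

text \<open>Barycentric coordinates are the working tool for the realization: the edge containing a
  point, and the parameter of the point there, are later read off from its coordinates.\<close>

lemma edge_path_nth:
  "edge_path a b s $ j = (1 - s) * (if j = a then 1 else 0) + s * (if j = b then 1 else 0)"
  by (auto simp: edge_path_def linepath_def axis_def)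

lemma edge_path_ends [simp]: "edge_path a b 0 = axis a 1" "edge_path a b 1 = axis b 1"
  by (simp_all add: edge_path_def linepath_def)

lemma edge_path_reverse: "edge_path b a s = edge_path a b (1 - s)"
  by (simp add: edge_path_def linepath_def add.commute)

lemma continuous_on_edge_path [continuous_intros]:
  "continuous_on A g \<Longrightarrow> continuous_on A (\<lambda>x. edge_path a b (g x))"
  unfolding edge_path_def linepath_def by (intro continuous_intros)

lemma convex_hull_edge:
  "convex hull ((\<lambda>a. axis a 1) ` {a, b}) = edge_path a b ` {0..1}"
proof -
  have "convex hull ((\<lambda>a. axis a 1) ` {a, b}) = closed_segment (axis a (1::real)) (axis b 1)"
    by (simp add: segment_convex_hull)
  then show ?thesis by (simp add: edge_path_def linepath_image_01)
qed

lemma realization_memI: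
  "{a, b} \<in> E \<Longrightarrow> 0 \<le> s \<Longrightarrow> s \<le> 1 \<Longrightarrow> edge_path a b s \<in> realization E"
  unfolding realization_def using convex_hull_edge[of a b] by fastforce

lemma realization_memE:
  assumes "x \<in> realization E" "\<forall>e\<in>E. card e = 2"
  obtains a b s where "{a, b} \<in> E" "a \<noteq> b" "0 \<le> s" "s \<le> 1" "x = edge_path a b s"
proof -
  obtain e where e: "e \<in> E" "x \<in> convex hull ((\<lambda>a. axis a 1) ` e)"
    using assms(1) unfolding realization_def by blast
  then obtain a b where ab: "e = {a, b}" "a \<noteq> b" using assms(2) by (metis card_2_iff)
  then show ?thesis using e that convex_hull_edge[of a b] by fastforce
qed

text \<open>For \<open>0 < s < 1\<close> both coordinates \<open>a\<close> and \<open>b\<close> are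
  nonzero, while a point of the edge \<open>cd\<close> has nonzero coordinates only at
  \<open>c\<close> and \<open>d\<close>; this would make the edges equal. So the common point is an
  end of \<open>ab\<close>.\<close>

lemma edge_paths_meet:
  assumes "edge_path a b s = edge_path c d t" "a \<noteq> b" "c \<noteq> d" "{a, b} \<noteq> {c, d}"
    and "0 \<le> s" "s \<le> 1"
  obtains v where "v \<in> {a, b} \<inter> {c, d}" "edge_path a b s = axis v 1"
proof -
  have eq: "edge_path a b s $ j = edge_path c d t $ j" for j using assms(1) by simp
  have in_cd: "j \<in> {c, d}" if "edge_path a b s $ j \<noteq> 0" for j
    using that unfolding eq by (auto simp: edge_path_nth split: if_splits)
  have "s = 0 \<or> s = 1"
  proof (rule ccontr)
    assume "\<not> (s = 0 \<or> s = 1)"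
    then have "a \<in> {c, d}" "b \<in> {c, d}"
      using in_cd[of a] in_cd[of b] assms(2) by (auto simp: edge_path_nth)
    then show False using assms(2-4) by auto
  qed
  then show ?thesis
  proof
    assume s: "s = 0"
    then have "a \<in> {c, d}" using in_cd[of a] assms(2) by (auto simp: edge_path_nth)
    then show ?thesis using that[of a] s by simp
  next
    assume s: "s = 1"
    then have "b \<in> {c, d}" using in_cd[of b] assms(2) by (auto simp: edge_path_nth)
    then show ?thesis using that[of b] s by simp
  qed
qed

lemma arc_edge_path: "a \<noteq> b \<Longrightarrow> arc (edge_path a b)"
  unfolding edge_path_def by (rule arc_linepath) (simp add: axis_eq_axis)

lemma path_image_edge_path: "path_image (edge_path a b) = realization {{a, b}}"
  using convex_hull_edge[of a b] unfolding realization_def path_image_def by simp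

lemma realization_insert: "realization (insert e E) = realization {e} \<union> realization E"
  by (auto simp: realization_def)

lemma path_edges_card: "distinct vs \<Longrightarrow> \<forall>e\<in>path_edges vs. card e = 2"
  by (induction vs rule: path_edges.induct) auto

text \<open>Edges are joined one at a time at the front. The new edge \<open>ab\<close> meets the
  arc already built only at \<open>axis b 1\<close>, since \<open>a\<close> lies on none of its
  edges.\<close>

lemma arc_along_vertices:
  fixes vs :: "'v::finite list"
  assumes "distinct vs" "2 \<le> length vs"
  shows "\<exists>g. arc g \<and> pathstart g = axis (hd vs) 1 \<and> pathfinish g = axis (last vs) 1 \<and>
    path_image g = realization (path_edges vs)"
  using assms
proof (induction vs rule: path_edges.induct)
  case (1 a b r)
  then have ab: "a \<noteq> b" by auto
  show ?case
  proof (cases r)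
    case Nil
    then show ?thesis
      using arc_edge_path[OF ab] path_image_edge_path[of a b]
      by (intro exI[of _ "edge_path a b"]) (auto simp: pathstart_def pathfinish_def)
  next
    case (Cons c r')
    then obtain g where g: "arc g" "pathstart g = axis b 1" "pathfinish g = axis (last (b # r)) 1"
      "path_image g = realization (path_edges (b # r))"
      using 1 by auto
    have "path_image (edge_path a b) \<inter> path_image g \<subseteq> {pathstart g}"
    proof
      fix x assume x: "x \<in> path_image (edge_path a b) \<inter> path_image g"
      then have "x \<in> edge_path a b ` {0..1}" by (simp add: path_image_def)
      then obtain s where s: "x = edge_path a b s" "0 \<le> s" "s \<le> 1" by fastforce
      obtain c d t where t: "{c, d} \<in> path_edges (b # r)" "c \<noteq> d" "x = edge_path c d t"
        using x g(4) path_edges_card[of "b # r"] 1 realization_memE by (metis IntD2 distinct.simps(2))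
      have "a \<notin> {c, d}" using path_edges_subset_Pow[OF t(1)] 1(2) by auto
      then obtain v where "v \<in> {a, b} \<inter> {c, d}" "x = axis v 1"
        using edge_paths_meet[of a b s c d t] s t ab by (metis insertI1)
      then show "x \<in> {pathstart g}" using g(2) \<open>a \<notin> {c, d}\<close> by auto
    qed
    then have "arc (edge_path a b +++ g)"
      using arc_join[OF arc_edge_path[OF ab] g(1)] g(2) by (simp add: pathfinish_def)
    moreover have "path_image (edge_path a b +++ g) = realization (path_edges (a # b # r))"
    proof -
      have "path_image (edge_path a b +++ g) = realization {{a, b}} \<union> realization (path_edges (b # r))"
        using path_image_join[of "edge_path a b" g] g(2,4) path_image_edge_path[of a b]
        by (simp add: pathfinish_def)
      then show ?thesis by (simp only: path_edges.simps realization_insert[of "{a, b}" "path_edges (b # r)"])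
    qed
    moreover have "pathstart (edge_path a b +++ g) = axis (hd (a # b # r)) 1"
      by (simp add: pathstart_def[of "edge_path a b"])
    moreover have "pathfinish (edge_path a b +++ g) = axis (last (a # b # r)) 1"
      using g(3) by simp
    ultimately show ?thesis by blast
  qed
qed auto

text \<open>With at least three vertices the indices \<open>length vs - 1\<close> and 0 are not
  consecutive; with two, the closing edge would repeat the only edge.\<close>

lemma last_hd_notin_path_edges:
  assumes "distinct vs" "3 \<le> length vs"
  shows "{last vs, hd vs} \<notin> path_edges vs"
proof
  assume "{last vs, hd vs} \<in> path_edges vs"
  then obtain i where i: "Suc i < length vs" "{last vs, hd vs} = {vs ! i, vs ! Suc i}"
    unfolding path_edges_conv_nth by blast
  have "vs \<noteq> []" using assms by auto
  then have "{vs ! (length vs - 1), vs ! 0} = {vs ! i, vs ! Suc i}"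
    using i by (simp add: last_conv_nth hd_conv_nth)
  then have "{length vs - 1, 0} = {i, Suc i}"
    using i(1) assms \<open>vs \<noteq> []\<close>
    by (auto simp: doubleton_eq_iff nth_eq_iff_index_eq)
  then show False using assms(2) by (auto simp: doubleton_eq_iff)
qed

text \<open>Joining the arc through the vertices with the edge from the last to the first gives a
  simple closed path. This is the passage from vertex lists to topological circles;
  \<open>simple_loop_follows_cycle\<close> goes the other way.\<close>

lemma realization_cycle_homeomorphic:
  fixes vs :: "'v::finite list"
  assumes "distinct vs" "3 \<le> length vs"
  shows "realization (cycle_edges vs) homeomorphic sphere (0::complex) 1"
proof -
  obtain g where g: "arc g" "pathstart g = axis (hd vs) 1" "pathfinish g = axis (last vs) 1"
    "path_image g = realization (path_edges vs)"
    using arc_along_vertices[of vs] assms by auto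
  let ?a = "last vs" and ?b = "hd vs"
  have ab: "?a \<noteq> ?b"
    using assms by (cases vs rule: list.exhaust[case_product list.exhaust]) (auto split: if_splits)
  have "path_image g \<inter> path_image (edge_path ?a ?b) \<subseteq> {pathstart g, pathstart (edge_path ?a ?b)}"
  proof
    fix x assume x: "x \<in> path_image g \<inter> path_image (edge_path ?a ?b)"
    then obtain s where s: "x = edge_path ?a ?b s" "0 \<le> s" "s \<le> 1"
      by (auto simp: path_image_def)
    obtain c d t where t: "{c, d} \<in> path_edges vs" "c \<noteq> d" "x = edge_path c d t"
      using x g(4) path_edges_card[of vs] assms(1) realization_memE by (metis IntD1)
    have "{?a, ?b} \<noteq> {c, d}" using last_hd_notin_path_edges[OF assms] t(1) by metis
    then obtain v where "v \<in> {?a, ?b} \<inter> {c, d}" "x = axis v 1"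
      using edge_paths_meet[of ?a ?b s c d t] s t ab by metis
    then show "x \<in> {pathstart g, pathstart (edge_path ?a ?b)}"
      using g(2) by (auto simp: pathstart_def[of "edge_path ?a ?b"])
  qed
  then have "simple_path (g +++ edge_path ?a ?b)"
    using simple_path_join_loop[OF g(1) arc_edge_path[OF ab]] g(2,3)
    by (simp add: pathstart_def[of "edge_path ?a ?b"] pathfinish_def[of "edge_path ?a ?b"])
  moreover have "path_image (g +++ edge_path ?a ?b) = realization (cycle_edges vs)"
  proof -
    have "path_image (g +++ edge_path ?a ?b) = realization (path_edges vs) \<union> realization {{?a, ?b}}"
      using path_image_join[of g "edge_path ?a ?b"] g(3,4) path_image_edge_path[of ?a ?b]
      by (simp add: pathstart_def[of "edge_path ?a ?b"])
    then show ?thesis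
      by (simp only: cycle_edges_def realization_insert[of "{?a, ?b}" "path_edges vs"] Un_commute)
  qed
  moreover have "pathfinish (g +++ edge_path ?a ?b) = pathstart (g +++ edge_path ?a ?b)"
    using g(2) by (simp add: pathfinish_def[of "edge_path ?a ?b"])
  ultimately show ?thesis
    using homeomorphic_simple_path_image_circle[of "g +++ edge_path ?a ?b" 1 0] by simp
qed

section \<open>Simple closed paths as cyclic vertex sequences\<close>

lemma continuous_on_frac_loop:
  fixes p :: "real \<Rightarrow> 'a::topological_space"
  assumes "path p" "pathfinish p = pathstart p"
  shows "continuous_on UNIV (\<lambda>t. p (frac t))"
proof -
  \<comment> \<open>On one period the function is a translate of \<open>p\<close>, at the right end
    because \<open>p\<close> is closed. Two adjacent periods are then glued around each
    point.\<close>
  have piece: "continuous_on {of_int n..of_int n + 1} (\<lambda>t. p (frac t))" for n :: int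
  proof -
    have "continuous_on {of_int n..of_int n + 1} (\<lambda>t. p (t - of_int n))"
      using assms(1) unfolding path_def
      by (rule continuous_on_compose2) (auto intro!: continuous_intros)
    moreover have "p (frac t) = p (t - of_int n)" if "t \<in> {of_int n..of_int n + 1}" for t
    proof (cases "t = of_int n + 1")
      case True
      then have "frac t = 0" by (metis frac_of_int of_int_1 of_int_add)
      then show ?thesis using assms(2) True by (simp add: pathfinish_def pathstart_def)
    next
      case False
      then have "\<lfloor>t\<rfloor> = n" using that by (simp add: floor_eq_iff)
      then show ?thesis by (simp add: frac_def)
    qed
    ultimately show ?thesis by (metis (no_types, lifting) continuous_on_cong)
  qed
  have "isCont (\<lambda>t. p (frac t)) x" for x
  proof -
    define n where "n = \<lfloor>x\<rfloor>"
    have "continuous_on ({of_int (n - 1)..of_int (n - 1) + 1} \<union> {of_int n..of_int n + 1}) (\<lambda>t. p (frac t))"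
      by (intro continuous_on_closed_Un piece) auto
    then have "continuous_on {of_int n - 1<..<of_int n + 1} (\<lambda>t. p (frac t))"
      by (rule continuous_on_subset) auto
    moreover have "x \<in> {of_int n - 1<..<of_int n + 1}"
    proof -
      have "of_int \<lfloor>x\<rfloor> - 1 < x" "x < of_int \<lfloor>x\<rfloor> + 1" by linarith+
      then show ?thesis by (simp add: n_def)
    qed
    ultimately show ?thesis
      by (simp add: continuous_on_eq_continuous_at)
  qed
  then show ?thesis by (simp add: continuous_at_imp_continuous_on)
qed

lemma frac_loop_eq_iff:
  assumes "simple_path p" "pathfinish p = pathstart p"
  shows "p (frac s) = p (frac t) \<longleftrightarrow> frac s = frac t"
proof
  assume eq: "p (frac s) = p (frac t)"
  have "frac s \<in> {0..1}" "frac t \<in> {0..1}" "frac s < 1" "frac t < 1"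
    by (auto simp: frac_lt_1 less_imp_le)
  then show "frac s = frac t"
    using assms(1) eq unfolding simple_path_def loop_free_def by fastforce
qed simp

lemma frac_eq_imp_eq:
  assumes "frac s = frac t" "\<bar>s - t\<bar> < (1::real)"
  shows "s = t"
proof -
  have "s - t = of_int (\<lfloor>s\<rfloor> - \<lfloor>t\<rfloor>)" using assms(1) by (simp add: frac_def)
  moreover from this assms(2) have "\<lfloor>s\<rfloor> - \<lfloor>t\<rfloor> = 0"
    by linarith
  ultimately show ?thesis by simp
qed

text \<open>Iterating the map to the next element of \<open>T\<close> cannot jump over
  \<open>t0 + 1\<close>, which lies in \<open>T\<close>, and by finiteness must reach it;
  \<open>k\<close> is the index where it does. The map commutes with the shift by 1, so the period
  holds at all indices.\<close>

lemma periodic_discrete_enumeration: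
  fixes T :: "real set"
  assumes per: "\<And>t. t + 1 \<in> T \<longleftrightarrow> t \<in> T" and fin: "\<And>t. finite (T \<inter> {t..t + 1})" and t0: "t0 \<in> T"
  obtains \<tau> :: "nat \<Rightarrow> real" and k where "strict_mono \<tau>" "\<And>i. \<tau> i \<in> T"
    "\<And>i t. \<tau> i < t \<Longrightarrow> t < \<tau> (Suc i) \<Longrightarrow> t \<notin> T" "0 < k" "\<And>i. \<tau> (i + k) = \<tau> i + 1"
proof -
  define nxt where "nxt t = Min (T \<inter> {t<..t + 1})" for t
  have nxt: "nxt t \<in> T" "t < nxt t" "\<And>u. t < u \<Longrightarrow> u < nxt t \<Longrightarrow> u \<notin> T" if "t \<in> T" for t
  proof -
    have f: "finite (T \<inter> {t<..t + 1})" by (rule finite_subset[OF _ fin[of t]]) auto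
    have "t + 1 \<in> T \<inter> {t<..t + 1}" using per that by auto
    then have m: "nxt t \<in> T \<inter> {t<..t + 1}" unfolding nxt_def using f Min_in by blast
    then show "nxt t \<in> T" "t < nxt t" by auto
    show "u \<notin> T" if "t < u" "u < nxt t" for u
    proof
      assume "u \<in> T"
      then have "u \<in> T \<inter> {t<..t + 1}" using that m by auto
      then have "nxt t \<le> u" unfolding nxt_def using f by simp
      then show False using that by simp
    qed
  qed
  have nxt_eq: "nxt t = u" if "t \<in> T" "u \<in> T" "t < u" "\<And>v. t < v \<Longrightarrow> v < u \<Longrightarrow> v \<notin> T" for t u
    using nxt[OF that(1)] that by (meson linorder_cases)
  have nxt_per: "nxt (t + 1) = nxt t + 1" if "t \<in> T" for t
  proof (rule nxt_eq)
    show "v \<notin> T" if v: "t + 1 < v" "v < nxt t + 1" for v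
      using nxt(3)[OF \<open>t \<in> T\<close>, of "v - 1"] v per[of "v - 1"] by auto
  qed (use per nxt that in auto)
  define \<tau> where "\<tau> = (\<lambda>i. (nxt ^^ i) t0)"
  have Suc: "\<tau> (Suc i) = nxt (\<tau> i)" for i by (simp add: \<tau>_def)
  have T: "\<tau> i \<in> T" for i
  proof (induction i)
    case 0 then show ?case using t0 by (simp add: \<tau>_def)
  qed (simp add: Suc nxt)
  have mono: "strict_mono \<tau>" by (simp add: strict_mono_Suc_iff Suc nxt T)
  have "\<exists>i. t0 + 1 \<le> \<tau> i"
  proof (rule ccontr)
    assume "\<not> ?thesis"
    then have "\<tau> i \<in> T \<inter> {t0..t0 + 1}" for i
      using T strict_mono_less_eq[OF mono, of 0 i] by (auto simp: \<tau>_def not_le less_imp_le)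
    then have "finite (range \<tau>)" by (intro finite_subset[OF _ fin[of t0]]) auto
    then show False
      using finite_imageD strict_mono_imp_inj_on[OF mono] infinite_UNIV_nat by blast
  qed
  define k where "k = (LEAST i. t0 + 1 \<le> \<tau> i)"
  have k: "t0 + 1 \<le> \<tau> k" unfolding k_def by (rule LeastI_ex) fact
  have k0: "k \<noteq> 0" using k by (cases k) (auto simp: \<tau>_def)
  then obtain j where j: "k = Suc j" by (cases k) auto
  have "\<tau> j < t0 + 1" using not_less_Least[of j "\<lambda>i. t0 + 1 \<le> \<tau> i"] j unfolding k_def by simp
  moreover have "t0 + 1 \<in> T" using per t0 by simp
  ultimately have "\<tau> k = t0 + 1"
    using nxt(3)[OF T[of j], of "t0 + 1"] k unfolding j Suc by (metis le_less)
  then have "\<tau> (i + k) = \<tau> i + 1" for i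
  proof (induction i)
    case 0 then show ?case by (simp add: \<tau>_def)
  next
    case (Suc i)
    then show ?case using nxt_per[OF T[of i]] by (simp add: \<open>\<And>i. \<tau> (Suc i) = nxt (\<tau> i)\<close>)
  qed
  then show ?thesis using that[OF mono T _ _ , of k] nxt(3)[OF T] k0 by (auto simp: Suc)
qed

lemma realization_mem_two_positive:
  fixes x :: "real ^ 'v::finite"
  assumes "x \<in> realization C" "\<forall>e\<in>C. card e = 2" "a \<noteq> b" "0 < x $ a" "0 < x $ b"
  obtains s where "{a, b} \<in> C" "0 < s" "s < 1" "x = edge_path a b s"
proof -
  obtain c d s where s: "{c, d} \<in> C" "c \<noteq> d" "0 \<le> s" "s \<le> 1" "x = edge_path c d s"
    using realization_memE[OF assms(1,2)] by metis
  then have "a \<in> {c, d}" "b \<in> {c, d}"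
    using assms(4,5) by (auto simp: edge_path_nth split: if_splits)
  then consider "a = c" "b = d" | "a = d" "b = c" using assms(3) by auto
  then show ?thesis
  proof cases
    case 1 then show ?thesis using s assms that[of s] by (auto simp: edge_path_nth)
  next
    case 2 then show ?thesis
      using s assms that[of "1 - s"] edge_path_reverse[of c d s]
      by (auto simp: edge_path_nth insert_commute)
  qed
qed

text \<open>The times at which the loop passes a vertex are discrete and 1-periodic. Between two
  consecutive ones it stays in a single edge, by connectedness, and cannot return to the vertex it
  left, by injectivity. So it traverses the edge from end to end, and its position there is the
  coordinate of the far end.\<close>

lemma simple_loop_follows_cycle:
  fixes p :: "real \<Rightarrow> real ^ 'v::finite"
  defines "q \<equiv> \<lambda>t. p (frac t)"
  assumes C: "\<forall>e\<in>C. card e = 2" and p: "parametrizes p C"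
  obtains w :: "nat \<Rightarrow> 'v" and \<tau> :: "nat \<Rightarrow> real" and k where
    "3 \<le> k" "\<And>i. w (i + k) = w i" "inj_on w {..<k}" "C = (\<lambda>i. {w i, w (Suc i)}) ` {..<k}" "card C = k"
    "strict_mono \<tau>" "\<And>i. \<tau> (i + k) = \<tau> i + 1"
    "\<And>i. q (\<tau> i) = axis (w i) 1"
    "\<And>i t. \<tau> i \<le> t \<Longrightarrow> t \<le> \<tau> (Suc i) \<Longrightarrow>
       0 \<le> q t $ w (Suc i) \<and> q t $ w (Suc i) \<le> 1 \<and> q t = edge_path (w i) (w (Suc i)) (q t $ w (Suc i))"
proof -
  have sp: "simple_path p" "pathfinish p = pathstart p" "path_image p = realization C"
    using p by (auto simp: parametrizes_def)
  have cont: "continuous_on UNIV q"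
    unfolding q_def by (rule continuous_on_frac_loop) (use sp simple_path_imp_path in auto)
  have q_eq: "q s = q t \<longleftrightarrow> frac s = frac t" for s t
    unfolding q_def by (rule frac_loop_eq_iff[OF sp(1,2)])
  have q_inj: "s = t" if "q s = q t" "\<bar>s - t\<bar> < 1" for s t
    using that frac_eq_imp_eq q_eq by blast
  have q_per: "q (t + 1) = q t" for t by (simp add: q_eq frac_1_eq)
  have q_C: "q t \<in> realization C" for t
    using sp(3) frac_lt_1[of t] by (auto simp: q_def path_image_def intro: less_imp_le)
  have q_onto: "\<exists>t\<in>{t0..<t0 + 1}. q t = x" if x: "x \<in> realization C" for x t0
  proof -
    have "x \<in> p ` {0..1}" using x sp(3) by (simp add: path_image_def)
    then obtain u where u: "u \<in> {0..1}" "p u = x" by blast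
    have "q u = x"
    proof (cases "u = 1")
      case True then show ?thesis
        using u sp(2) by (simp add: q_def pathstart_def pathfinish_def)
    next
      case False then have "frac u = u" using u(1) by (simp add: frac_eq)
      then show ?thesis using u(2) by (simp add: q_def)
    qed
    moreover have "frac (t0 + frac (u - t0)) = frac u"
    proof -
      have "t0 + frac (u - t0) = u - of_int \<lfloor>u - t0\<rfloor>" by (simp add: frac_def)
      moreover have "frac (u - of_int n) = frac u" for n by (simp add: frac_def)
      ultimately show ?thesis by simp
    qed
    ultimately show ?thesis
      using q_eq frac_lt_1[of "u - t0"] by (intro bexI[of _ "t0 + frac (u - t0)"]) auto
  qed
  define T where "T = {t. \<exists>a. q t = axis a 1}"
  obtain a b where "{a, b} \<in> C" using realization_memE[OF q_C[of 0] C] by metis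
  then have "axis a 1 \<in> realization C" using realization_memI[of a b C 0] by simp
  then obtain t0 where t0: "t0 \<in> T" using q_onto unfolding T_def by blast
  have fin: "finite (T \<inter> {t..t + 1})" for t
  proof -
    have "inj_on q (T \<inter> {t..<t + 1})" by (rule inj_onI, rule q_inj) auto
    moreover have "q ` (T \<inter> {t..<t + 1}) \<subseteq> (\<lambda>a. axis a 1) ` UNIV" by (auto simp: T_def)
    then have "finite (q ` (T \<inter> {t..<t + 1}))" by (rule finite_subset) simp
    ultimately have "finite (insert (t + 1) (T \<inter> {t..<t + 1}))" by (simp add: finite_image_iff)
    then show ?thesis by (rule finite_subset[rotated]) auto
  qed
  obtain \<tau> :: "nat \<Rightarrow> real" and k where \<tau>: "strict_mono \<tau>" "\<And>i. \<tau> i \<in> T"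
    "\<And>i t. \<tau> i < t \<Longrightarrow> t < \<tau> (Suc i) \<Longrightarrow> t \<notin> T" "0 < k" "\<And>i. \<tau> (i + k) = \<tau> i + 1"
    by (rule periodic_discrete_enumeration[of T t0]) (use fin t0 in \<open>auto simp: T_def q_per\<close>)
  define w where "w i = (SOME a. q (\<tau> i) = axis a 1)" for i
  have w: "q (\<tau> i) = axis (w i) 1" for i
    unfolding w_def by (rule someI_ex) (use \<tau>(2)[of i] in \<open>simp add: T_def\<close>)
  have w_per: "w (i + k) = w i" for i unfolding w_def \<tau>(5) q_per ..
  have gap: "\<tau> (Suc i) \<le> \<tau> i + 1" for i
    using strict_mono_less_eq[OF \<tau>(1), of "Suc i" "i + k"] \<tau>(4,5) by auto
  have step: "\<tau> i < \<tau> (Suc i)" for i using \<tau>(1) by (simp add: strict_mono_def)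

  have edge: "{w i, w (Suc i)} \<in> C \<and> w i \<noteq> w (Suc i) \<and>
     (\<forall>t\<in>{\<tau> i..\<tau> (Suc i)}. q t \<in> edge_path (w i) (w (Suc i)) ` {0..1})" for i
  proof -
    let ?I = "{\<tau> i<..<\<tau> (Suc i)}"
    \<comment> \<open>On the realization, for an edge \<open>e\<close> this open condition describes
      the interior points of \<open>e\<close>. Interiors of distinct edges are disjoint, so
      connectedness of the open time interval keeps the loop in the edge met at its midpoint
      \<open>m\<close>.\<close>
    define opn where "opn e = {x :: real ^ 'v. \<forall>j\<in>e. 0 < x $ j}" for e
    have openO: "open (q -` opn e)" for e
    proof -
      have "opn e = (\<Inter>j\<in>e. {x. 0 < x $ j})" by (auto simp: opn_def)
      moreover have "open (\<Inter>j\<in>e. {x :: real ^ 'v. 0 < x $ j})"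
        by (intro open_INT finite ballI open_Collect_less continuous_intros)
      ultimately show ?thesis using open_vimage[OF _ cont] by metis
    qed
    have inside: "\<exists>a b s. {a, b} \<in> C \<and> a \<noteq> b \<and> 0 < s \<and> s < 1 \<and> q t = edge_path a b s"
      if t: "t \<in> ?I" for t
    proof -
      obtain a b s where s: "{a, b} \<in> C" "a \<noteq> b" "0 \<le> s" "s \<le> 1" "q t = edge_path a b s"
        using realization_memE[OF q_C[of t] C] by metis
      have "t \<notin> T" using \<tau>(3) t by auto
      then have "s \<noteq> 0" "s \<noteq> 1" using s(5) by (auto simp: T_def)
      then show ?thesis using s by (intro exI[of _ a] exI[of _ b] exI[of _ s]) auto
    qed
    define m where "m = (\<tau> i + \<tau> (Suc i)) / 2"
    have m: "m \<in> ?I" using step[of i] by (simp add: m_def)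
    obtain a b s where ab: "{a, b} \<in> C" "a \<noteq> b" "0 < s" "s < 1" "q m = edge_path a b s"
      using inside[OF m] by blast
    define U where "U = q -` opn {a, b}"
    define V where "V = (\<Union>e\<in>C - {{a, b}}. q -` opn e)"
    have "U \<inter> V \<inter> ?I = {}"
    proof -
      have False if t: "q t \<in> opn {a, b}" "e \<in> C" "e \<noteq> {a, b}" "q t \<in> opn e" for t e
      proof -
        obtain r where r: "q t = edge_path a b r"
          using realization_mem_two_positive[OF q_C[of t] C ab(2)] t(1) unfolding opn_def by auto
        obtain c d where cd: "e = {c, d}" "c \<noteq> d" using C t(2) by (metis card_2_iff)
        then have "c \<in> {a, b}" "d \<in> {a, b}"
          using t(4) r by (auto simp: opn_def edge_path_nth split: if_splits)
        then show False using cd t(3) by auto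
      qed
      then show ?thesis unfolding U_def V_def by blast
    qed
    moreover have cover: "t \<in> U \<union> V" if "t \<in> ?I" for t
    proof -
      obtain c d r where r: "{c, d} \<in> C" "c \<noteq> d" "0 < r" "r < 1" "q t = edge_path c d r"
        using inside[OF \<open>t \<in> ?I\<close>] by blast
      then have "q t \<in> opn {c, d}" by (auto simp: opn_def edge_path_nth)
      then show ?thesis
        using r(1) unfolding U_def V_def by (cases "{c, d} = {a, b}") auto
    qed
    moreover have "open U" "open V"
      unfolding U_def V_def by (auto intro: openO)
    moreover have "m \<in> U \<inter> ?I"
      using ab m by (auto simp: U_def opn_def edge_path_nth)
    ultimately have "V \<inter> ?I = {}"
      using connectedD[OF connected_Ioo, of U V "\<tau> i" "\<tau> (Suc i)"] by blast
    then have pos: "0 < q t $ a \<and> 0 < q t $ b" if "t \<in> ?I" for t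
      using cover[OF that] that by (auto simp: U_def opn_def)
    have "q ` ?I \<subseteq> edge_path a b ` {0..1}"
    proof
      fix x assume "x \<in> q ` ?I"
      then obtain t where t: "t \<in> ?I" "x = q t" by blast
      then obtain r where "x = edge_path a b r" "0 < r" "r < 1"
        using realization_mem_two_positive[OF q_C C ab(2), of t] pos by blast
      then show "x \<in> edge_path a b ` {0..1}" by auto
    qed
    moreover have "closed (edge_path a b ` {0..1})"
      by (intro compact_imp_closed compact_continuous_image continuous_on_edge_path continuous_on_id) auto
    ultimately have "q ` closure ?I \<subseteq> edge_path a b ` {0..1}"
      using image_closure_subset[of ?I q] cont continuous_on_subset by blast
    then have img: "q t \<in> edge_path a b ` {0..1}" if "t \<in> {\<tau> i..\<tau> (Suc i)}" for t
      using that step[of i] by auto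
    have w_ab: "w j \<in> {a, b}" if "j = i \<or> j = Suc i" for j
    proof -
      have "axis (w j) 1 \<in> edge_path a b ` {0..1}"
        using img[of "\<tau> j"] that step[of i] w[of j] by auto
      then obtain r where "axis (w j) 1 = edge_path a b r" by blast
      then have "edge_path a b r $ w j = 1" by (metis axis_nth)
      then show ?thesis by (auto simp: edge_path_nth split: if_splits)
    qed
    \<comment> \<open>If both ends were the same vertex, the coordinate of the other end
      \<open>c\<close> would start and finish at 0 and take half its value at \<open>m\<close> both
      before and after \<open>m\<close>. Within one edge equal coordinates mean equal points,
      against injectivity.\<close>
    have ne: "w i \<noteq> w (Suc i)"
    proof
      assume same: "w i = w (Suc i)"
      obtain c where c: "c \<in> {a, b}" "c \<noteq> w i" using ab(2) by auto
      have ends: "q (\<tau> i) $ c = 0" "q (\<tau> (Suc i)) $ c = 0"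
        using c(2) same by (auto simp: w axis_def)
      have m_c: "0 < q m $ c" using pos[OF m] c(1) by auto
      have contc: "continuous_on S (\<lambda>t. q t $ c)" for S
        by (intro continuous_intros continuous_on_subset[OF cont]) auto
      obtain x where x: "\<tau> i \<le> x" "x \<le> m" "q x $ c = q m $ c / 2"
        using IVT'[of "\<lambda>t. q t $ c" "\<tau> i" "q m $ c / 2" m] ends m_c m contc by auto
      obtain y where y: "m \<le> y" "y \<le> \<tau> (Suc i)" "q y $ c = q m $ c / 2"
        using IVT2'[of "\<lambda>t. q t $ c" "\<tau> (Suc i)" "q m $ c / 2" m] ends m_c m contc by auto
      obtain rx where rx: "q x = edge_path a b rx" using img[of x] x m by auto
      obtain ry where ry: "q y = edge_path a b ry" using img[of y] y m by auto
      have "rx = ry" using x(3) y(3) c(1) ab(2) unfolding rx ry by (auto simp: edge_path_nth)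
      then have "q x = q y" by (simp add: rx ry)
      moreover have xy: "x < m" "m < y" "\<tau> i < x" using x y m_c ends by (auto simp: order_less_le)
      then have "\<bar>x - y\<bar> < 1" using gap[of i] y(2) by auto
      ultimately show False using q_inj xy by fastforce
    qed
    then have "{w i, w (Suc i)} = {a, b}" using w_ab[of i] w_ab[of "Suc i"] by auto
    then consider "a = w i" "b = w (Suc i)" | "b = w i" "a = w (Suc i)"
      using ne by (auto simp: doubleton_eq_iff)
    then show ?thesis
    proof cases
      case 1 then show ?thesis using ab img ne by auto
    next
      case 2
      have "edge_path a b ` {0..1} = edge_path b a ` {0..1}"
        using convex_hull_edge[of a b] convex_hull_edge[of b a] by (simp add: insert_commute)
      then show ?thesis using ab img ne 2 by (auto simp: insert_commute)
    qed
  qed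
  have on_edge: "0 \<le> q t $ w (Suc i) \<and> q t $ w (Suc i) \<le> 1 \<and>
      q t = edge_path (w i) (w (Suc i)) (q t $ w (Suc i))"
    if "\<tau> i \<le> t" "t \<le> \<tau> (Suc i)" for i t
  proof -
    obtain s where "s \<in> {0..1}" "q t = edge_path (w i) (w (Suc i)) s"
      using edge[of i] \<open>\<tau> i \<le> t\<close> \<open>t \<le> \<tau> (Suc i)\<close> by fastforce
    then show ?thesis using edge[of i] by (auto simp: edge_path_nth)
  qed
  have mid: "\<exists>t. \<tau> i < t \<and> t < \<tau> (Suc i) \<and> q t = edge_path (w i) (w (Suc i)) (1/2)" for i
  proof -
    have "continuous_on {\<tau> i..\<tau> (Suc i)} (\<lambda>t. q t $ w (Suc i))"
      by (intro continuous_intros continuous_on_subset[OF cont]) auto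
    moreover have e: "q (\<tau> i) $ w (Suc i) = 0" "q (\<tau> (Suc i)) $ w (Suc i) = 1"
      using edge[of i] by (auto simp: w axis_def)
    ultimately obtain t where t: "\<tau> i \<le> t" "t \<le> \<tau> (Suc i)" "q t $ w (Suc i) = 1/2"
      using IVT'[of "\<lambda>t. q t $ w (Suc i)" "\<tau> i" "1/2" "\<tau> (Suc i)"] step[of i] by auto
    moreover have "t \<noteq> \<tau> i" "t \<noteq> \<tau> (Suc i)" using t(3) e by auto
    moreover have "q t = edge_path (w i) (w (Suc i)) (1/2)"
      using on_edge[OF t(1,2)] by (simp only: t(3))
    ultimately show ?thesis by (intro exI[of _ t]) auto
  qed
  have \<tau>_near: "\<bar>\<tau> i - \<tau> j\<bar> < 1" if "i < k" "j < k" for i j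
    using strict_mono_less[OF \<tau>(1), of i "j + k"] strict_mono_less[OF \<tau>(1), of j "i + k"] that
      \<tau>(5)[of i] \<tau>(5)[of j] by auto
  have inj: "inj_on w {..<k}"
  proof (rule inj_onI)
    fix i j assume ij: "i \<in> {..<k}" "j \<in> {..<k}" "w i = w j"
    then have "\<tau> i = \<tau> j" using q_inj[of "\<tau> i" "\<tau> j"] \<tau>_near by (simp add: w)
    then show "i = j" using strict_mono_eq[OF \<tau>(1)] by blast
  qed
  \<comment> \<open>The midpoint is the same for both directions of an edge, so an edge visited
    twice would give equal values of the loop at two times less than a period apart.\<close>
  have inj_edge: "inj_on (\<lambda>i. {w i, w (Suc i)}) {..<k}"
  proof (rule inj_onI)
    fix i j assume ij: "i \<in> {..<k}" "j \<in> {..<k}" "{w i, w (Suc i)} = {w j, w (Suc j)}"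
    obtain s where s: "\<tau> i < s" "s < \<tau> (Suc i)" "q s = edge_path (w i) (w (Suc i)) (1/2)"
      using mid by blast
    obtain t where t: "\<tau> j < t" "t < \<tau> (Suc j)" "q t = edge_path (w j) (w (Suc j)) (1/2)"
      using mid by blast
    have "q s = q t"
      using ij(3) s(3) t(3) edge_path_reverse[of "w i" "w (Suc i)" "1/2"] by (auto simp: doubleton_eq_iff)
    moreover have "\<bar>s - t\<bar> < 1"
    proof -
      have "\<tau> (Suc i) \<le> \<tau> (j + k)" "\<tau> (Suc j) \<le> \<tau> (i + k)"
        using ij by (auto simp: strict_mono_less_eq[OF \<tau>(1)])
      then show ?thesis using s t by (simp add: \<tau>(5))
    qed
    ultimately have "s = t" by (rule q_inj)
    then have "\<tau> i < \<tau> (Suc j)" "\<tau> j < \<tau> (Suc i)" using s t by linarith+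
    then show "i = j" by (simp add: strict_mono_less[OF \<tau>(1)])
  qed
  have C_eq: "C = (\<lambda>i. {w i, w (Suc i)}) ` {..<k}"
  proof
    show "(\<lambda>i. {w i, w (Suc i)}) ` {..<k} \<subseteq> C" using edge by blast
    show "C \<subseteq> (\<lambda>i. {w i, w (Suc i)}) ` {..<k}"
    proof
      fix e assume "e \<in> C"
      obtain a b where e: "e = {a, b}" "a \<noteq> b" using C \<open>e \<in> C\<close> by (metis card_2_iff)
      then have "edge_path a b (1/2) \<in> realization C" using realization_memI[of a b C] \<open>e \<in> C\<close> by simp
      then obtain t where t: "t \<in> {\<tau> 0..<\<tau> 0 + 1}" "q t = edge_path a b (1/2)" using q_onto by blast
      \<comment> \<open>The last vertex time not after \<open>t\<close>. As \<open>t\<close> lies in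
        the period from \<open>\<tau> 0\<close> to \<open>\<tau> k\<close>, excluding its right end,
        \<open>i < k\<close>.\<close>
      define i where "i = (GREATEST i. \<tau> i \<le> t)"
      have bound: "j \<le> k" if "\<tau> j \<le> t" for j
      proof (rule ccontr)
        assume "\<not> j \<le> k"
        then have "\<tau> k < \<tau> j" using strict_mono_less[OF \<tau>(1), of k j] by simp
        then show False using that t(1) \<tau>(5)[of 0] by auto
      qed
      have i: "\<tau> i \<le> t"
        unfolding i_def by (rule GreatestI_nat[of _ 0 k]) (use t bound in auto)
      have i': "t < \<tau> (Suc i)"
      proof (rule ccontr)
        assume "\<not> t < \<tau> (Suc i)"
        then have "Suc i \<le> i" unfolding i_def
          by (intro Greatest_le_nat[of _ _ k]) (use bound in auto)
        then show False by simp
      qed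
      have "i \<noteq> k" using i t(1) \<tau>(5)[of 0] by auto
      then have "i < k" using bound[OF i] by simp
      have eq: "edge_path a b (1/2) = edge_path (w i) (w (Suc i)) (q t $ w (Suc i))"
        using on_edge[of i t] i i' t(2) by auto
      have "j \<in> {w i, w (Suc i)}" if "j \<in> {a, b}" for j
      proof (rule ccontr)
        assume "j \<notin> {w i, w (Suc i)}"
        then have "edge_path a b (1/2) $ j = 0" unfolding eq by (simp add: edge_path_nth)
        then show False using that e(2) by (auto simp: edge_path_nth)
      qed
      then have "e = {w i, w (Suc i)}" using e by auto
      then show "e \<in> (\<lambda>i. {w i, w (Suc i)}) ` {..<k}" using \<open>i < k\<close> by blast
    qed
  qed
  \<comment> \<open>\<open>k = 1\<close> would give an edge with equal ends, and
    \<open>k = 2\<close> would use one edge twice.\<close>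
  have "k \<noteq> 1" using edge[of 0] w_per[of 0] by auto
  moreover have "k \<noteq> 2"
  proof
    assume "k = 2"
    then have "{w 0, w (Suc 0)} = {w 1, w (Suc 1)}" using w_per[of 0] by (auto simp: numeral_2_eq_2)
    then show False using inj_onD[OF inj_edge, of 0 1] \<open>k = 2\<close> by auto
  qed
  ultimately have "3 \<le> k" using \<tau>(4) by linarith
  moreover have "card C = k" using C_eq card_image[OF inj_edge] by simp
  ultimately show ?thesis by (intro that[OF _ w_per inj C_eq _ \<tau>(1,5) w on_edge])
qed

section \<open>Square roots of the secant map\<close>

text \<open>The diagonal, where secants vanish, is left out, and convexity of \<open>I\<close>
  passes to this strip. The bound \<open>\<mu>\<close> takes the place of the small
  \<open>\<epsilon>\<close> in the rotation number.\<close>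

definition secant_domain :: "real set \<Rightarrow> real \<Rightarrow> (real \<times> real) set" where
  "secant_domain I \<mu> = {(s, t). s \<in> I \<and> t \<in> I \<and> s < t \<and> t - s \<le> \<mu>}"

definition secant_root :: "(real \<Rightarrow> complex) \<Rightarrow> real set \<Rightarrow> real \<Rightarrow> (real \<times> real \<Rightarrow> complex) \<Rightarrow> bool" where
  "secant_root c I \<mu> S \<longleftrightarrow>
     continuous_on (secant_domain I \<mu>) S \<and>
     (\<forall>(s, t) \<in> secant_domain I \<mu>. S (s, t) ^ 2 = c t - c s \<and> S (s, t) \<noteq> 0)"

lemma secant_domain_iff [simp]:
  "(s, t) \<in> secant_domain I \<mu> \<longleftrightarrow> s \<in> I \<and> t \<in> I \<and> s < t \<and> t - s \<le> \<mu>"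
  by (simp add: secant_domain_def)

lemma secant_rootD:
  assumes "secant_root c I \<mu> S" "s \<in> I" "t \<in> I" "s < t" "t - s \<le> \<mu>"
  shows "S (s, t) ^ 2 = c t - c s" "S (s, t) \<noteq> 0"
  using assms unfolding secant_root_def by force+

lemma convex_secant_domain:
  assumes "convex I"
  shows "convex (secant_domain I \<mu>)"
proof (rule convexI)
  fix x y :: "real \<times> real" and u v :: real
  assume x: "x \<in> secant_domain I \<mu>" and y: "y \<in> secant_domain I \<mu>"
    and uv: "0 \<le> u" "0 \<le> v" "u + v = 1"
  obtain a b where ab: "x = (a, b)" by (cases x)
  obtain c d where cd: "y = (c, d)" by (cases y)
  have I: "u * a + v * c \<in> I" "u * b + v * d \<in> I"
    using convexD[OF assms, of a c u v] convexD[OF assms, of b d u v] x y uv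
    by (auto simp: ab cd)
  have lt: "u * a + v * c < u * b + v * d"
  proof (cases "u = 0")
    case True then show ?thesis using uv y by (simp add: cd)
  next
    case False
    then have "u * a < u * b" "v * c \<le> v * d"
      using x y uv by (auto simp: ab cd mult_left_mono)
    then show ?thesis by linarith
  qed
  have "u * (b - a) \<le> u * \<mu>" "v * (d - c) \<le> v * \<mu>"
    using x y uv by (auto simp: ab cd intro!: mult_left_mono)
  then have "u * (b - a) + v * (d - c) \<le> (u + v) * \<mu>"
    unfolding distrib_right by linarith
  then have "u * b + v * d - (u * a + v * c) \<le> \<mu>"
    using uv(3) by (simp add: algebra_simps)
  then show "u *\<^sub>R x + v *\<^sub>R y \<in> secant_domain I \<mu>"
    using I lt by (simp add: ab cd)
qed

lemma continuous_on_secant: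
  assumes "continuous_on I (c :: real \<Rightarrow> complex)"
  shows "continuous_on (secant_domain I \<mu>) (\<lambda>z. c (snd z) - c (fst z))"
  by (intro continuous_on_diff continuous_on_compose2[OF assms] continuous_intros)
     (auto simp: secant_domain_def)

lemma secant_root_exists:
  assumes "convex I" "continuous_on I c"
    and "\<And>s t. s \<in> I \<Longrightarrow> t \<in> I \<Longrightarrow> s < t \<Longrightarrow> t - s \<le> \<mu> \<Longrightarrow> c s \<noteq> c t"
  obtains S where "secant_root c I \<mu> S"
proof -
  have nz: "c (snd z) - c (fst z) \<noteq> 0" if "z \<in> secant_domain I \<mu>" for z
    using assms(3)[of "fst z" "snd z"] that by (auto simp: secant_domain_def)
  obtain g where "continuous_on (secant_domain I \<mu>) g"
      "\<And>z. z \<in> secant_domain I \<mu> \<Longrightarrow> c (snd z) - c (fst z) = (g z)\<^sup>2"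
    using continuous_sqrt_on_contractible[OF continuous_on_secant[OF assms(2)]
        convex_imp_contractible[OF convex_secant_domain[OF assms(1)]] nz]
    by metis
  then have "secant_root c I \<mu> g"
    using nz unfolding secant_root_def by force
  then show ?thesis using that by blast
qed

text \<open>The quotient squares to 1, hence is a continuous map into \<open>{1, -1}\<close> on a
  connected set.\<close>

lemma square_roots_agree_up_to_sign:
  fixes S T :: "'a::topological_space \<Rightarrow> complex"
  assumes "connected D" "continuous_on D S" "continuous_on D T"
    and "\<And>z. z \<in> D \<Longrightarrow> S z ^ 2 = T z ^ 2" "\<And>z. z \<in> D \<Longrightarrow> T z \<noteq> 0"
  shows "\<exists>e\<in>{1, -1}. \<forall>z\<in>D. S z = e * T z"
proof -
  have val: "S z / T z \<in> {1, -1}" if "z \<in> D" for z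
  proof -
    have "(S z / T z)\<^sup>2 = 1"
      using assms(4,5)[OF that] by (simp add: power_divide)
    then show ?thesis by (auto simp: power2_eq_1_iff)
  qed
  have "(\<lambda>z. S z / T z) constant_on D"
    by (intro continuous_finite_range_constant assms(1) continuous_on_divide assms)
       (use assms(5) val in \<open>auto intro: finite_subset[of _ "{1,-1}", OF image_subsetI] simp del: divide_eq_1_iff\<close>)
  then obtain e where e: "\<And>z. z \<in> D \<Longrightarrow> S z / T z = e"
    unfolding constant_on_def by blast
  show ?thesis
  proof (cases "D = {}")
    case False
    then obtain z0 where "z0 \<in> D" by blast
    then have "e \<in> {1, -1}" using val e by blast
    moreover have "S z = e * T z" if "z \<in> D" for z
      using e[OF that] assms(5)[OF that] by (auto simp: field_simps)
    ultimately show ?thesis by blast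
  qed auto
qed

lemma secant_root_unique:
  assumes "convex I" "secant_root c I \<mu> S" "secant_root c I \<mu> T"
  shows "\<exists>e\<in>{1, -1}. \<forall>z\<in>secant_domain I \<mu>. S z = e * T z"
proof (rule square_roots_agree_up_to_sign)
  show "connected (secant_domain I \<mu>)"
    by (rule convex_connected[OF convex_secant_domain[OF assms(1)]])
  show "S z ^ 2 = T z ^ 2" "T z \<noteq> 0" if "z \<in> secant_domain I \<mu>" for z
    using that secant_rootD[OF assms(2), of "fst z" "snd z"] secant_rootD[OF assms(3), of "fst z" "snd z"]
    by (auto simp: secant_domain_def)
qed (use assms(2,3) in \<open>auto simp: secant_root_def\<close>)

text \<open>An increasing time change keeps the order \<open>s < t\<close>, and \<open>small\<close>
  keeps the width bound, so the domain over \<open>J\<close> is mapped into the one over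
  \<open>I\<close>. This moves roots between the loop, its corners and its edges.\<close>

lemma secant_root_reparam:
  assumes S: "secant_root c I \<mu> S" and cont: "continuous_on J \<phi>"
    and mono: "\<And>s t. s \<in> J \<Longrightarrow> t \<in> J \<Longrightarrow> s < t \<Longrightarrow> \<phi> s < \<phi> t"
    and sub: "\<phi> ` J \<subseteq> I"
    and small: "\<And>s t. s \<in> J \<Longrightarrow> t \<in> J \<Longrightarrow> s < t \<Longrightarrow> t - s \<le> \<nu> \<Longrightarrow> \<phi> t - \<phi> s \<le> \<mu>"
    and d: "\<And>t. t \<in> J \<Longrightarrow> d t = c (\<phi> t)"
  shows "secant_root d J \<nu> (\<lambda>(s, t). S (\<phi> s, \<phi> t))"
  unfolding secant_root_def
proof (intro conjI ballI)
  have im: "(\<phi> s, \<phi> t) \<in> secant_domain I \<mu>" if "(s, t) \<in> secant_domain J \<nu>" for s t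
    using that mono sub small by auto
  have "continuous_on (secant_domain J \<nu>) (\<lambda>z. S (\<phi> (fst z), \<phi> (snd z)))"
  proof (rule continuous_on_compose2[of "secant_domain I \<mu>" S])
    show "continuous_on (secant_domain J \<nu>) (\<lambda>z. (\<phi> (fst z), \<phi> (snd z)))"
      by (intro continuous_intros continuous_on_compose2[OF cont]) auto
  qed (use S im in \<open>auto simp: secant_root_def\<close>)
  then show "continuous_on (secant_domain J \<nu>) (\<lambda>(s, t). S (\<phi> s, \<phi> t))"
    by (simp add: case_prod_unfold)
  fix z assume z: "z \<in> secant_domain J \<nu>"
  then show "case z of (s, t) \<Rightarrow> (case (s, t) of (s, t) \<Rightarrow> S (\<phi> s, \<phi> t))\<^sup>2 = d t - d s
           \<and> (case (s, t) of (s, t) \<Rightarrow> S (\<phi> s, \<phi> t)) \<noteq> 0"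
    using im S d unfolding secant_root_def by (cases z) fastforce
qed

lemma secant_root_mono:
  assumes "secant_root c I \<mu> S" "J \<subseteq> I" "\<nu> \<le> \<mu>"
  shows "secant_root c J \<nu> S"
proof -
  have "secant_root c J \<nu> (\<lambda>(s, t). S (id s, id t))"
    by (rule secant_root_reparam[OF assms(1)]) (use assms in auto)
  then show ?thesis by simp
qed

text \<open>Reversal exchanges the roles of the two times and negates the secant; the factor
  \<open>\<i>\<close>, whose square is -1, makes up for it.\<close>

lemma secant_root_reverse:
  assumes S: "secant_root c {0..l} \<mu> S"
  shows "secant_root (\<lambda>t. c (l - t)) {0..l} \<mu> (\<lambda>(s, t). \<i> * S (l - t, l - s))"
  unfolding secant_root_def
proof (intro conjI ballI)
  have im: "(l - t, l - s) \<in> secant_domain {0..l} \<mu>" if "(s, t) \<in> secant_domain {0..l} \<mu>" for s t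
    using that by auto
  have "continuous_on (secant_domain {0..l} \<mu>) (\<lambda>z. S (l - snd z, l - fst z))"
  proof (rule continuous_on_compose2[where g = S and t = "secant_domain {0..l} \<mu>"])
    show "continuous_on (secant_domain {0..l} \<mu>) S" using S by (simp add: secant_root_def)
    show "continuous_on (secant_domain {0..l} \<mu>) (\<lambda>z. (l - snd z, l - fst z))"
      by (intro continuous_intros)
  qed (use im in auto)
  then have "continuous_on (secant_domain {0..l} \<mu>) (\<lambda>z. \<i> * S (l - snd z, l - fst z))"
    by (intro continuous_on_mult continuous_on_const)
  then show "continuous_on (secant_domain {0..l} \<mu>) (\<lambda>(s, t). \<i> * S (l - t, l - s))"
    by (simp add: case_prod_unfold)
  fix z assume z: "z \<in> secant_domain {0..l} \<mu>"
  then obtain s t where st: "z = (s, t)" "(l - t, l - s) \<in> secant_domain {0..l} \<mu>"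
    using im by (cases z) auto
  then show "case z of (s, t) \<Rightarrow> (case (s, t) of (s, t) \<Rightarrow> \<i> * S (l - t, l - s))\<^sup>2 = c (l - t) - c (l - s)
           \<and> (case (s, t) of (s, t) \<Rightarrow> \<i> * S (l - t, l - s)) \<noteq> 0"
    using secant_rootD[OF S, of "l - t" "l - s"] by (simp add: power_mult_distrib)
qed

text \<open>The difference of the two logarithms takes values in a discrete set, since distinct
  integer multiples of \<open>2 * pi * \<i>\<close> are at distance at least 1. On a connected set
  it is therefore constant.\<close>

lemma logarithms_agree_up_to_period:
  fixes A B :: "'a::topological_space \<Rightarrow> complex"
  assumes "connected D" "continuous_on D A" "continuous_on D B"
    and "\<And>z. z \<in> D \<Longrightarrow> exp (A z) = exp (B z)"
  obtains n :: int where "\<And>z. z \<in> D \<Longrightarrow> A z = B z + of_int n * (2 * of_real pi * \<i>)"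
proof -
  have per: "\<exists>n::int. A z - B z = of_int n * (2 * of_real pi * \<i>)" if z: "z \<in> D" for z
  proof -
    have "exp (A z - B z) = 1" using assms(4)[OF z] by (simp add: exp_diff)
    then obtain n :: int where "Re (A z - B z) = 0" "Im (A z - B z) = of_int (2 * n) * pi"
      unfolding exp_eq_1 by auto
    then show ?thesis by (intro exI[of _ n]) (simp add: complex_eq_iff)
  qed
  have "(\<lambda>z. A z - B z) constant_on D"
  proof (rule continuous_discrete_range_constant[OF assms(1)])
    show "continuous_on D (\<lambda>z. A z - B z)" by (intro continuous_intros assms)
    fix x assume x: "x \<in> D"
    show "\<exists>e>0. \<forall>y. y \<in> D \<and> A y - B y \<noteq> A x - B x \<longrightarrow> e \<le> norm (A y - B y - (A x - B x))"
    proof (intro exI[of _ 1] conjI allI impI)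
      fix y assume y: "y \<in> D \<and> A y - B y \<noteq> A x - B x"
      obtain m n :: int where m: "A x - B x = of_int m * (2 * of_real pi * \<i>)"
        and n: "A y - B y = of_int n * (2 * of_real pi * \<i>)"
        using per x y by blast
      have "m \<noteq> n" using y m n by auto
      then have "1 \<le> \<bar>real_of_int (n - m)\<bar>" by linarith
      then have "1 * 1 \<le> \<bar>real_of_int (n - m)\<bar> * (2 * pi)"
        using pi_gt3 by (intro mult_mono) auto
      moreover have "A y - B y - (A x - B x) = of_int (n - m) * (2 * of_real pi * \<i>)"
        by (simp add: m n algebra_simps)
      then have "norm (A y - B y - (A x - B x)) = \<bar>real_of_int (n - m)\<bar> * (2 * pi)"
        by (simp only: norm_mult norm_of_int norm_of_real norm_ii mult_1_right) simp
      ultimately show "1 \<le> norm (A y - B y - (A x - B x))" by simp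
    qed simp
  qed
  then obtain m where m: "\<And>z. z \<in> D \<Longrightarrow> A z - B z = m" unfolding constant_on_def by blast
  show ?thesis
  proof (cases "D = {}")
    case True then show ?thesis using that by blast
  next
    case False
    then obtain n :: int where "m = of_int n * (2 * of_real pi * \<i>)" using per m by blast
    then show ?thesis using that[of n] m by (metis add.commute diff_add_cancel)
  qed
qed

section \<open>Parity of the rotation number as the monodromy of a square root\<close>

lemma frac_add_one [simp]: "frac (x + 1 :: real) = frac x"
  by (simp add: frac_1_eq)

text \<open>A logarithm \<open>L\<close> of the secant map on the strip grows by
  \<open>2 * pi * \<i> * n\<close> when both times are shifted by 1. Along the line
  \<open>t = s + \<epsilon>\<close> this growth is the winding of the secant direction, for every
  positive \<open>\<epsilon> \<le> \<mu>\<close>, so the rotation number is \<open>n\<close>. The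
  root \<open>exp (L / 2)\<close> is multiplied by \<open>exp (pi * \<i> * n)\<close>, the sign
  given by the parity of \<open>n\<close>.\<close>

lemma secant_root_rotation_number:
  fixes c :: "real \<Rightarrow> complex"
  defines "d \<equiv> \<lambda>t. c (frac t)"
  assumes cont: "continuous_on UNIV d" and \<mu>: "0 < \<mu>"
    and inj: "\<And>s t. s < t \<Longrightarrow> t - s \<le> \<mu> \<Longrightarrow> d s \<noteq> d t"
  obtains S where "secant_root d UNIV \<mu> S"
    "\<And>s t. s < t \<Longrightarrow> t - s \<le> \<mu> \<Longrightarrow>
       S (s + 1, t + 1) = (if even (rotation_number c) then 1 else -1) * S (s, t)"
proof -
  define D where "D = secant_domain UNIV \<mu>"
  have D: "convex D" by (simp add: D_def convex_secant_domain)
  have per: "d (t + 1) = d t" for t by (simp add: d_def)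
  have nz: "d (snd z) - d (fst z) \<noteq> 0" if "z \<in> D" for z
    using inj[of "fst z" "snd z"] that by (auto simp: D_def secant_domain_def)
  have "continuous_on D (\<lambda>z. d (snd z) - d (fst z))"
    unfolding D_def by (rule continuous_on_secant[OF cont])
  then obtain L where L: "continuous_on D L" "\<And>z. z \<in> D \<Longrightarrow> d (snd z) - d (fst z) = exp (L z)"
    using continuous_logarithm_on_contractible[where S = D and f = "\<lambda>z. d (snd z) - d (fst z)"]
      convex_imp_contractible[OF D] nz by blast
  have shift: "(fst z + 1, snd z + 1) \<in> D" if "z \<in> D" for z
    using that by (auto simp: D_def secant_domain_def)
  have "continuous_on D (\<lambda>z. L (fst z + 1, snd z + 1))"
    by (rule continuous_on_compose2[OF L(1)]) (use shift in \<open>auto intro!: continuous_intros\<close>)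
  moreover have "exp (L (fst z + 1, snd z + 1)) = exp (L z)" if "z \<in> D" for z
    using L(2)[OF that] L(2)[OF shift[OF that]] by (simp add: per)
  ultimately obtain n :: int
    where n: "\<And>z. z \<in> D \<Longrightarrow> L (fst z + 1, snd z + 1) = L z + of_int n * (2 * of_real pi * \<i>)"
    using logarithms_agree_up_to_period[OF convex_connected[OF D], of _ L] L(1) by blast
  have wn: "winding_number (secant_direction c \<epsilon>) 0 = of_int n" if "0 < \<epsilon>" "\<epsilon> \<le> \<mu>" for \<epsilon>
  proof -
    have inD: "(t, t + \<epsilon>) \<in> D" for t using that by (simp add: D_def)
    \<comment> \<open>Normalizing a secant discards the real part of its logarithm.\<close>
    define l where "l = (\<lambda>t. \<i> * of_real (Im (L (t, t + \<epsilon>))))"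
    have contl: "continuous_on UNIV l"
      unfolding l_def by (intro continuous_intros continuous_on_compose2[OF L(1)]) (use inD in auto)
    have sec: "secant_direction c \<epsilon> t = exp (l t)" for t
    proof -
      have "secant_direction c \<epsilon> t = sgn (exp (L (t, t + \<epsilon>)))"
        using L(2)[OF inD[of t]] by (simp add: secant_direction_def d_def)
      also have "\<dots> = exp (l t)"
      proof -
        have "exp (L (t, t + \<epsilon>)) = of_real (exp (Re (L (t, t + \<epsilon>)))) * exp (l t)"
          by (metis complex_eq exp_add exp_of_real l_def)
        then show ?thesis
          by (simp add: l_def sgn_mult sgn_of_real norm_mult flip: cis_conv_exp)
      qed
      finally show ?thesis .
    qed
    have path: "path (secant_direction c \<epsilon>)"
      unfolding path_def sec by (intro continuous_on_exp continuous_on_subset[OF contl]) auto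
    have "0 \<notin> path_image (secant_direction c \<epsilon>)"
      by (auto simp: path_image_def sec)
    then obtain q where q: "path q"
        "pathfinish q - pathstart q = 2 * of_real pi * \<i> * winding_number (secant_direction c \<epsilon>) 0"
        "\<And>t. t \<in> {0..1} \<Longrightarrow> secant_direction c \<epsilon> t = 0 + exp (q t)"
      using winding_number_as_continuous_log[OF path] by metis
    \<comment> \<open>\<open>q\<close> and \<open>l\<close> are logarithms of the same path on the
      unit interval, so they have the same increment, and that of \<open>l\<close> is known from
      \<open>n\<close>.\<close>
    obtain k :: int where k: "\<And>t. t \<in> {0..1} \<Longrightarrow> q t = l t + of_int k * (2 * of_real pi * \<i>)"
    proof (rule logarithms_agree_up_to_period)
      show "continuous_on {0..1} q" using q(1) by (simp add: path_def)
      show "continuous_on {0..1} l" by (rule continuous_on_subset[OF contl]) simp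
      show "exp (q t) = exp (l t)" if "t \<in> {0..1}" for t using q(3)[OF that] by (simp add: sec)
    qed auto
    have "q 1 - q 0 = l 1 - l 0" using k[of 0] k[of 1] by simp
    also have "\<dots> = of_int n * (2 * of_real pi * \<i>)"
      using n[OF inD[of 0]] by (simp add: l_def algebra_simps)
    finally show ?thesis using q(2) by (simp add: pathfinish_def pathstart_def mult.commute)
  qed
  have ev: "\<forall>\<^sub>F \<epsilon> in at_right 0. winding_number (secant_direction c \<epsilon>) 0 = of_int n"
    using eventually_at_right_less[of 0] eventually_at_right_real[OF \<mu>]
    by eventually_elim (auto intro: wn)
  have rot: "rotation_number c = n"
    unfolding rotation_number_def
  proof (rule the_equality, rule ev)
    \<comment> \<open>The filter \<open>at_right 0\<close> is not trivial, so two values that hold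
      eventually must agree; this makes the description of the rotation number definite.\<close>
    fix k :: int assume "\<forall>\<^sub>F \<epsilon> in at_right 0. winding_number (secant_direction c \<epsilon>) 0 = of_int k"
    with ev have "\<forall>\<^sub>F \<epsilon> in at_right (0::real). k = n"
      by eventually_elim auto
    then show "k = n" by (simp add: eventually_const_iff trivial_limit_at_right_real)
  qed
  define S where "S = (\<lambda>z. exp (L z / 2))"
  have sq: "S z ^ 2 = exp (L z)" for z
    by (simp add: S_def flip: exp_double)
  have "secant_root d UNIV \<mu> S"
    unfolding secant_root_def
  proof (intro conjI ballI)
    show "continuous_on (secant_domain UNIV \<mu>) S"
      unfolding S_def using L(1) D_def by (intro continuous_on_exp continuous_on_divide) auto
    show "case z of (s, t) \<Rightarrow> (S (s, t))\<^sup>2 = d t - d s \<and> S (s, t) \<noteq> 0"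
      if "z \<in> secant_domain UNIV \<mu>" for z
      using L(2)[of z] that sq[of z] by (cases z) (simp add: D_def, simp add: S_def)
  qed
  moreover have "S (s + 1, t + 1) = (if even (rotation_number c) then 1 else -1) * S (s, t)"
    if "s < t" "t - s \<le> \<mu>" for s t
  proof -
    have "L (s + 1, t + 1) / 2 = L (s, t) / 2 + of_int n * (of_real pi * \<i>)"
      using n[of "(s, t)"] that by (simp add: D_def field_simps)
    then have "S (s + 1, t + 1) = S (s, t) * exp (of_int n * (of_real pi * \<i>))"
      unfolding S_def by (simp only: exp_add)
    moreover have "exp (of_int n * (of_real pi * \<i>)) = (if even n then 1 else -1)"
      by (auto elim!: evenE oddE simp: exp_add algebra_simps exp_eq_1)
    ultimately show ?thesis by (simp add: rot)
  qed
  ultimately show ?thesis using that by blast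
qed

section \<open>Signs of corners\<close>

text \<open>\<open>\<eta>\<close> is a Lebesgue number of the cover of \<open>K\<close> by open sets
  on which \<open>f\<close> is injective.\<close>

lemma uniform_local_injectivity:
  fixes f :: "'a::metric_space \<Rightarrow> 'b"
  assumes "compact K" "\<And>x. x \<in> K \<Longrightarrow> \<exists>U. open U \<and> x \<in> U \<and> inj_on f (U \<inter> K)"
  obtains \<eta> where "0 < \<eta>" "\<And>x y. x \<in> K \<Longrightarrow> y \<in> K \<Longrightarrow> x \<noteq> y \<Longrightarrow> dist x y < \<eta> \<Longrightarrow> f x \<noteq> f y"
proof -
  obtain \<eta> where \<eta>: "0 < \<eta>" "\<forall>x\<in>K. \<exists>T\<in>{U. open U \<and> inj_on f (U \<inter> K)}. ball x \<eta> \<subseteq> T"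
    by (rule Heine_Borel_lemma[OF assms(1), of "{U. open U \<and> inj_on f (U \<inter> K)}"])
       (use assms(2) in blast)+
  show ?thesis
  proof (rule that[OF \<eta>(1)])
    fix x y assume xy: "x \<in> K" "y \<in> K" "x \<noteq> y" "dist x y < \<eta>"
    then obtain T where "inj_on f (T \<inter> K)" "ball x \<eta> \<subseteq> T" using \<eta>(2) by blast
    moreover from this have "x \<in> T \<inter> K" "y \<in> T \<inter> K"
      using xy \<eta>(1) by (auto simp: subset_iff)
    ultimately show "f x \<noteq> f y" using xy(3) by (auto dest: inj_onD)
  qed
qed

lemma compact_realization: "compact (realization (E :: 'v::finite set set))"
  unfolding realization_def
  by (intro compact_UN finite ballI finite_imp_compact_convex_hull) auto

text \<open>The vertex \<open>v\<close> sits at time 1, and the corner is left unsmoothed: secants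
  across it take the place of a turning tangent.\<close>

definition corner_path :: "'v::finite \<Rightarrow> 'v \<Rightarrow> 'v \<Rightarrow> real \<Rightarrow> real ^ 'v" where
  "corner_path a v b s = (if s \<le> 1 then edge_path a v s else edge_path v b (s - 1))"

lemma corner_path_second: "1 \<le> s \<Longrightarrow> corner_path a v b s = edge_path v b (s - 1)"
  by (cases "s = 1") (auto simp: corner_path_def)

lemma corner_path_reverse: "corner_path b v a s = corner_path a v b (2 - s)"
proof (cases s "1::real" rule: linorder_cases)
  case less then show ?thesis using edge_path_reverse[of b v s] by (simp add: corner_path_def)
next
  case greater then show ?thesis using edge_path_reverse[of v a "s - 1"] by (simp add: corner_path_def)
qed (simp add: corner_path_def)

text \<open>The factor 2 is the crude bound on the distance of two unit vectors; it is the origin of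
  \<open>2 * \<mu>\<close> in the assumption \<open>scale\<close> below.\<close>

lemma edge_path_dist: "dist (edge_path a b s) (edge_path a b t) \<le> 2 * \<bar>s - t\<bar>"
proof -
  have "edge_path a b s - edge_path a b t = (s - t) *\<^sub>R (axis b 1 - axis a 1)"
    by (simp add: edge_path_def linepath_def algebra_simps)
  then have "dist (edge_path a b s) (edge_path a b t) = \<bar>s - t\<bar> * norm (axis b 1 - axis a 1 :: real ^ 'a)"
    by (simp add: dist_norm)
  also have "\<dots> \<le> \<bar>s - t\<bar> * 2"
  proof (rule mult_left_mono)
    show "norm (axis b 1 - axis a 1 :: real ^ 'a) \<le> 2"
      by (rule order_trans[OF norm_triangle_ineq4]) simp
  qed simp
  finally show ?thesis by simp
qed

lemma corner_path_dist:
  assumes "s \<le> t"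
  shows "dist (corner_path a v b s) (corner_path a v b t) \<le> 2 * (t - s)"
proof -
  consider "t \<le> 1" | "1 \<le> s" | "s < 1" "1 < t" by linarith
  then show ?thesis
  proof cases
    case 1
    then show ?thesis using assms edge_path_dist[of a v s t] by (simp add: corner_path_def)
  next
    case 2
    then show ?thesis using assms edge_path_dist[of v b "s - 1" "t - 1"] by (simp add: corner_path_second)
  next
    case 3
    have "dist (corner_path a v b s) (corner_path a v b t) \<le>
        dist (edge_path a v s) (edge_path a v 1) + dist (edge_path v b 0) (edge_path v b (t - 1))"
      using 3 dist_triangle[of "edge_path a v s" "edge_path v b (t - 1)" "axis v 1"]
      by (simp add: corner_path_def)
    also have "\<dots> \<le> 2 * (1 - s) + 2 * (t - 1)"
      using edge_path_dist[of a v s 1] edge_path_dist[of v b 0 "t - 1"] 3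
      by (intro add_mono) (simp_all add: abs_of_neg abs_of_pos)
    finally show ?thesis by simp
  qed
qed

text \<open>On the first edge the coordinates of \<open>a\<close> and \<open>b\<close> are
  \<open>1 - s\<close> and 0, on the second 0 and \<open>s - 1\<close>, so one formula inverts both
  halves. It shows that the corner does not meet itself, and it later serves as the time change from
  the loop to the corner.\<close>

lemma corner_path_coordinate:
  assumes "a \<noteq> b" "a \<noteq> v" "b \<noteq> v"
  shows "1 + corner_path a v b s $ b - corner_path a v b s $ a = s"
  using assms by (auto simp: corner_path_def edge_path_nth)

lemma continuous_on_corner_path: "continuous_on A (corner_path a v b)"
proof -
  have "continuous_on UNIV (corner_path a v b)"
    unfolding corner_path_def
    by (rule continuous_on_cases_le[where h = "\<lambda>s. s"]) (auto intro!: continuous_intros)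
  then show ?thesis using continuous_on_subset by blast
qed

lemma continuous_injective_imp_increasing:
  fixes \<phi> :: "real \<Rightarrow> real"
  assumes "continuous_on {l..r} \<phi>" "inj_on \<phi> {l..r}" "\<phi> l < \<phi> r"
    and "l \<le> s" "s < t" "t \<le> r"
  shows "\<phi> s < \<phi> t"
proof -
  have mono: "\<phi> x < \<phi> y \<and> \<phi> y < \<phi> z \<or> \<phi> z < \<phi> y \<and> \<phi> y < \<phi> x"
    if "l \<le> x" "x < y" "y < z" "z \<le> r" for x y z
  proof (rule continuous_inj_imp_mono[of x y z \<phi>])
    show "continuous_on {x..z} \<phi>" "inj_on \<phi> {x..z}"
      using that by (auto intro: continuous_on_subset[OF assms(1)] inj_on_subset[OF assms(2)])
  qed (use that in auto)
  have lower: "\<phi> l < \<phi> x" if "l < x" "x \<le> r" for x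
    using mono[of l x r] that assms(3) by (cases "x = r") auto
  show ?thesis
  proof (cases "l = s")
    case True then show ?thesis using lower assms by auto
  next
    case False
    then show ?thesis using mono[of l s t] lower[of s] assms by auto
  qed
qed

text \<open>\<open>U\<close> marks one colour class. \<open>\<mu>\<close> is the width bound for
  secants: edges and corners have speed at most 2, so times at most \<open>\<mu>\<close> apart give
  points at most \<open>2 * \<mu>\<close> apart, and the secant between their images is nonzero if
  the points differ.\<close>

locale immersed_bipartite_graph =
  fixes E :: "'v::finite set set" and f :: "real ^ 'v \<Rightarrow> complex" and U :: "'v \<Rightarrow> bool" and \<mu> :: real
  assumes simple: "\<forall>e\<in>E. card e = 2"
    and bipartite: "\<And>a b. {a, b} \<in> E \<Longrightarrow> U a \<noteq> U b"
    and cont: "continuous_on (realization E) f"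
    and scale: "0 < \<mu>"
      "\<And>x y. x \<in> realization E \<Longrightarrow> y \<in> realization E \<Longrightarrow> x \<noteq> y \<Longrightarrow> dist x y \<le> 2 * \<mu> \<Longrightarrow> f x \<noteq> f y"
begin

lemma edge_ne: "{a, b} \<in> E \<Longrightarrow> a \<noteq> b"
  using bipartite by blast

text \<open>The sign of the root is an arbitrary choice. The opposite choice would negate the signs
  of the corners at this edge; a cycle through the edge has two of these, so its product is
  unaffected.\<close>

definition base_root :: "'v \<Rightarrow> 'v \<Rightarrow> real \<times> real \<Rightarrow> complex" where
  "base_root a b = (SOME S. secant_root (\<lambda>t. f (edge_path a b t)) {0..1} \<mu> S)"

definition edge_root :: "'v \<Rightarrow> 'v \<Rightarrow> real \<times> real \<Rightarrow> complex" where
  "edge_root a b =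
     (if U a then base_root a b else (\<lambda>(s, t). \<i> * base_root b a (1 - t, 1 - s)))"

lemma base_root:
  assumes "{a, b} \<in> E"
  shows "secant_root (\<lambda>t. f (edge_path a b t)) {0..1} \<mu> (base_root a b)"
proof -
  have "\<exists>S. secant_root (\<lambda>t. f (edge_path a b t)) {0..1} \<mu> S"
  proof (rule secant_root_exists)
    show "continuous_on {0..1} (\<lambda>t. f (edge_path a b t))"
      by (rule continuous_on_compose2[OF cont])
         (auto intro!: continuous_intros realization_memI[OF assms])
    fix s t :: real assume st: "s \<in> {0..1}" "t \<in> {0..1}" "s < t" "t - s \<le> \<mu>"
    have "edge_path a b s $ b = s" "edge_path a b t $ b = t"
      using edge_ne[OF assms] by (auto simp: edge_path_nth)
    then have "edge_path a b s \<noteq> edge_path a b t" using st(3) by auto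
    moreover have "dist (edge_path a b s) (edge_path a b t) \<le> 2 * \<mu>"
      using edge_path_dist[of a b s t] st by auto
    ultimately show "f (edge_path a b s) \<noteq> f (edge_path a b t)"
      using st assms by (intro scale realization_memI) auto
  qed auto
  then show ?thesis unfolding base_root_def by (rule someI_ex)
qed

lemma edge_root:
  assumes "{a, b} \<in> E"
  shows "secant_root (\<lambda>t. f (edge_path a b t)) {0..1} \<mu> (edge_root a b)"
proof (cases "U a")
  case True then show ?thesis using base_root[OF assms] by (simp add: edge_root_def)
next
  case False
  have "secant_root (\<lambda>t. f (edge_path b a (1 - t))) {0..1} \<mu> (\<lambda>(s, t). \<i> * base_root b a (1 - t, 1 - s))"
    using assms by (intro secant_root_reverse base_root) (simp add: insert_commute)
  then show ?thesis using False by (simp add: edge_root_def edge_path_reverse[of b a])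
qed

text \<open>\<open>- \<i>\<close> occurs as the inverse of \<open>\<i>\<close>. This asymmetry
  between the colour classes is what makes the reversal of a corner flip its sign.\<close>

lemma edge_root_reverse:
  assumes "{a, b} \<in> E"
  shows "edge_root b a (s, t) = (if U a then \<i> else - \<i>) * edge_root a b (1 - t, 1 - s)"
  using bipartite[OF assms] by (auto simp: edge_root_def)

text \<open>The root \<open>S\<close> along the corner is fixed only up to a sign, which changes
  \<open>e\<close> and \<open>e'\<close> together; only their product is meaningful.\<close>

definition corner_sign :: "'v \<Rightarrow> 'v \<Rightarrow> 'v \<Rightarrow> complex \<Rightarrow> bool" where
  "corner_sign a v b n \<longleftrightarrow>
     (\<exists>S e e'. secant_root (\<lambda>t. f (corner_path a v b t)) {0..2} \<mu> S \<and> e \<in> {1, -1} \<and> e' \<in> {1, -1} \<and>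
        (\<forall>(s, t)\<in>secant_domain {0..1} \<mu>. S (s, t) = e * edge_root a v (s, t)) \<and>
        (\<forall>(s, t)\<in>secant_domain {0..1} \<mu>. S (s + 1, t + 1) = e' * edge_root v b (s, t)) \<and>
        n = e * e')"

lemma corner_sign_exists:
  assumes av: "{a, v} \<in> E" and vb: "{v, b} \<in> E" and ab: "a \<noteq> b"
  shows "\<exists>n. corner_sign a v b n"
proof -
  have mem: "corner_path a v b s \<in> realization E" if "s \<in> {0..2}" for s
    using that realization_memI[OF av, of s] realization_memI[OF vb, of "s - 1"]
    by (auto simp: corner_path_def)
  obtain S where S: "secant_root (\<lambda>t. f (corner_path a v b t)) {0..2} \<mu> S"
  proof (rule secant_root_exists)
    show "continuous_on {0..2} (\<lambda>t. f (corner_path a v b t))"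
      by (rule continuous_on_compose2[OF cont continuous_on_corner_path]) (use mem in auto)
    fix s t :: real assume st: "s \<in> {0..2}" "t \<in> {0..2}" "s < t" "t - s \<le> \<mu>"
    have "corner_path a v b s \<noteq> corner_path a v b t"
      using corner_path_coordinate[OF ab edge_ne[OF av] edge_ne[OF vb, symmetric]] st(3)
      by (metis less_irrefl)
    moreover have "dist (corner_path a v b s) (corner_path a v b t) \<le> 2 * \<mu>"
      using corner_path_dist[of s t a v b] st by auto
    ultimately show "f (corner_path a v b s) \<noteq> f (corner_path a v b t)"
      using st by (intro scale mem) auto
  qed auto
  have "secant_root (\<lambda>t. f (edge_path a v t)) {0..1} \<mu> (\<lambda>(s, t). S (s, t))"
    by (rule secant_root_reparam[OF S]) (auto simp: corner_path_def)
  then obtain e where e: "e \<in> {1, -1}"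
      "\<forall>z\<in>secant_domain {0..1} \<mu>. (\<lambda>(s, t). S (s, t)) z = e * edge_root a v z"
    using secant_root_unique[OF _ _ edge_root[OF av]] by (metis convex_real_interval(5))
  have "secant_root (\<lambda>t. f (edge_path v b t)) {0..1} \<mu> (\<lambda>(s, t). S (s + 1, t + 1))"
    by (rule secant_root_reparam[OF S]) (auto simp: corner_path_second intro!: continuous_intros)
  then obtain e' where e': "e' \<in> {1, -1}"
      "\<forall>z\<in>secant_domain {0..1} \<mu>. (\<lambda>(s, t). S (s + 1, t + 1)) z = e' * edge_root v b z"
    using secant_root_unique[OF _ _ edge_root[OF vb]] by (metis convex_real_interval(5))
  have "corner_sign a v b (e * e')"
    unfolding corner_sign_def
    by (intro exI[of _ S] exI[of _ e] exI[of _ e'] conjI S e(1) e'(1) refl) (use e(2) e'(2) in auto)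
  then show ?thesis by blast
qed

text \<open>A sample point of the domain: comparing two roots at one nonzero value determines the
  sign between them.\<close>

lemma short_secant: "(0, min \<mu> 1) \<in> secant_domain {0..1} \<mu>"
  using scale(1) by auto

lemma edge_root_nonzero:
  "{a, b} \<in> E \<Longrightarrow> (s, t) \<in> secant_domain {0..1} \<mu> \<Longrightarrow> edge_root a b (s, t) \<noteq> 0"
  using secant_rootD(2)[OF edge_root, of a b s t] by auto

lemma corner_sign_unique:
  assumes av: "{a, v} \<in> E" and vb: "{v, b} \<in> E"
    and "corner_sign a v b m" "corner_sign a v b n"
  shows "m = n"
proof -
  obtain S e e' where S: "secant_root (\<lambda>t. f (corner_path a v b t)) {0..2} \<mu> S"
    and e: "\<And>s t. (s, t)\<in>secant_domain {0..1} \<mu> \<Longrightarrow> S (s, t) = e * edge_root a v (s, t)"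
      "\<And>s t. (s, t)\<in>secant_domain {0..1} \<mu> \<Longrightarrow> S (s + 1, t + 1) = e' * edge_root v b (s, t)" "m = e * e'"
    using assms(3) unfolding corner_sign_def by blast
  obtain T d d' where T: "secant_root (\<lambda>t. f (corner_path a v b t)) {0..2} \<mu> T"
    and d: "\<And>s t. (s, t)\<in>secant_domain {0..1} \<mu> \<Longrightarrow> T (s, t) = d * edge_root a v (s, t)"
      "\<And>s t. (s, t)\<in>secant_domain {0..1} \<mu> \<Longrightarrow> T (s + 1, t + 1) = d' * edge_root v b (s, t)" "n = d * d'"
    using assms(4) unfolding corner_sign_def by blast
  obtain c where c: "c \<in> {1, -1}" "\<forall>z\<in>secant_domain {0..2} \<mu>. S z = c * T z"
    using secant_root_unique[OF _ S T] by blast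
  let ?h = "min \<mu> 1"
  have "(0, ?h) \<in> secant_domain {0..2} \<mu>" "(0 + 1, ?h + 1) \<in> secant_domain {0..2} \<mu>"
    using scale(1) by auto
  then have "S (0, ?h) = c * T (0, ?h)" "S (0 + 1, ?h + 1) = c * T (0 + 1, ?h + 1)"
    using c(2) by blast+
  then have "e * edge_root a v (0, ?h) = c * d * edge_root a v (0, ?h)"
      "e' * edge_root v b (0, ?h) = c * d' * edge_root v b (0, ?h)"
    unfolding e(1)[OF short_secant] e(2)[OF short_secant] d(1)[OF short_secant] d(2)[OF short_secant]
    by (simp_all only: mult.assoc)
  then have "e = c * d" "e' = c * d'"
    using edge_root_nonzero[OF av short_secant] edge_root_nonzero[OF vb short_secant] by auto
  then show ?thesis using c(1) e(3) d(3) by auto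
qed

text \<open>Dividing the factor \<open>\<i>\<close> of the reversed root by the factor of each
  reversed edge root leaves 1 or -1, according to the colour of \<open>v\<close> for the edge
  \<open>vb\<close> and of \<open>a\<close> for the edge \<open>av\<close>. As \<open>a\<close> and
  \<open>v\<close> have different colours, exactly one of the two signs changes.\<close>

lemma corner_sign_reverse:
  assumes av: "{a, v} \<in> E" and vb: "{v, b} \<in> E" and n: "corner_sign a v b n"
  shows "corner_sign b v a (- n)"
proof -
  obtain S e e' where S: "secant_root (\<lambda>t. f (corner_path a v b t)) {0..2} \<mu> S"
    and e: "e \<in> {1, -1}" "e' \<in> {1, -1}"
      "\<And>s t. (s, t)\<in>secant_domain {0..1} \<mu> \<Longrightarrow> S (s, t) = e * edge_root a v (s, t)"
      "\<And>s t. (s, t)\<in>secant_domain {0..1} \<mu> \<Longrightarrow> S (s + 1, t + 1) = e' * edge_root v b (s, t)"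
      "n = e * e'"
    using n unfolding corner_sign_def by blast
  define T where "T = (\<lambda>(s, t). \<i> * S (2 - t, 2 - s))"
  have T: "secant_root (\<lambda>t. f (corner_path b v a t)) {0..2} \<mu> T"
    unfolding T_def corner_path_reverse[of b v a] by (rule secant_root_reverse[OF S])
  have rev: "(1 - t, 1 - s) \<in> secant_domain {0..1} \<mu>" if "(s, t) \<in> secant_domain {0..1} \<mu>" for s t
    using that by auto
  have first: "T (s, t) = (if U v then 1 else -1) * e' * edge_root b v (s, t)"
    if st: "(s, t) \<in> secant_domain {0..1} \<mu>" for s t
  proof -
    have "T (s, t) = \<i> * (e' * edge_root v b (1 - t, 1 - s))"
      using e(4)[OF rev[OF st]] by (simp add: T_def)
    then show ?thesis by (simp add: edge_root_reverse[OF vb])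
  qed
  have second: "T (s + 1, t + 1) = (if U a then 1 else -1) * e * edge_root v a (s, t)"
    if st: "(s, t) \<in> secant_domain {0..1} \<mu>" for s t
  proof -
    have "T (s + 1, t + 1) = \<i> * (e * edge_root a v (1 - t, 1 - s))"
      using e(3)[OF rev[OF st]] by (simp add: T_def)
    then show ?thesis by (simp add: edge_root_reverse[OF av])
  qed
  show ?thesis
    unfolding corner_sign_def
  proof (intro exI conjI)
    show "secant_root (\<lambda>t. f (corner_path b v a t)) {0..2} \<mu> T" by (rule T)
    show "- n = ((if U v then 1 else -1) * e') * ((if U a then 1 else -1) * e)"
      using bipartite[OF av] e(5) by auto
  qed (use e(1,2) first second in auto)
qed

definition turn :: "'v \<Rightarrow> 'v \<Rightarrow> 'v \<Rightarrow> complex" where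
  "turn a v b = (THE n. corner_sign a v b n)"

lemma corner_sign_turn:
  assumes "{a, v} \<in> E" "{v, b} \<in> E" "a \<noteq> b"
  shows "corner_sign a v b (turn a v b)"
proof -
  have "\<exists>!n. corner_sign a v b n"
    using corner_sign_exists[OF assms] corner_sign_unique[OF assms(1,2)] by blast
  then show ?thesis unfolding turn_def by (rule theI')
qed

lemma turn_sign: "{a, v} \<in> E \<Longrightarrow> {v, b} \<in> E \<Longrightarrow> a \<noteq> b \<Longrightarrow> turn a v b \<in> {1, -1}"
  using corner_sign_turn[of a v b] unfolding corner_sign_def by auto

lemma turn_reverse:
  assumes "{a, v} \<in> E" "{v, b} \<in> E" "a \<noteq> b"
  shows "turn b v a = - turn a v b"
proof (rule corner_sign_unique)
  show "corner_sign b v a (turn b v a)"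
    using corner_sign_turn[of b v a] assms by (simp add: insert_commute)
  show "corner_sign b v a (- turn a v b)"
    using corner_sign_reverse[OF assms(1,2) corner_sign_turn[OF assms]] .
qed (use assms in \<open>auto simp: insert_commute\<close>)

text \<open>Comparing one root \<open>S\<close> along the whole loop with the root of each edge
  passed gives signs \<open>\<epsilon> i\<close>. The turn at a corner is
  \<open>\<epsilon> i * \<epsilon> (Suc i)\<close>, so the product around the cycle telescopes to
  \<open>\<epsilon> 0 * \<epsilon> k\<close>, which the monodromy of \<open>S\<close> identifies
  with the parity sign \<open>\<sigma>\<close>.\<close>

lemma rotation_number_turns:
  assumes C: "C \<subseteq> E" and p: "parametrizes p C"
  obtains w :: "nat \<Rightarrow> 'v" and k where
    "3 \<le> k" "\<And>i. w (i + k) = w i" "inj_on w {..<k}" "C = (\<lambda>i. {w i, w (Suc i)}) ` {..<k}" "card C = k"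
    "(if even (rotation_number (f \<circ> p)) then 1 else -1) =
       (\<Prod>i<k. turn (w i) (w (Suc i)) (w (Suc (Suc i))))"
proof -
  define q where "q t = p (frac t)" for t
  have card_C: "\<forall>e\<in>C. card e = 2" using C simple by blast
  obtain w :: "nat \<Rightarrow> 'v" and \<tau> :: "nat \<Rightarrow> real" and k where
    k: "3 \<le> k" and w_per: "\<And>i. w (i + k) = w i" and w_inj: "inj_on w {..<k}"
    and C_eq: "C = (\<lambda>i. {w i, w (Suc i)}) ` {..<k}" and cardC: "card C = k"
    and mono: "strict_mono \<tau>" and \<tau>_per: "\<And>i. \<tau> (i + k) = \<tau> i + 1"
    and at_\<tau>: "\<And>i. q (\<tau> i) = axis (w i) 1"
    and on_edge: "\<And>i t. \<tau> i \<le> t \<Longrightarrow> t \<le> \<tau> (Suc i) \<Longrightarrow>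
       0 \<le> q t $ w (Suc i) \<and> q t $ w (Suc i) \<le> 1 \<and> q t = edge_path (w i) (w (Suc i)) (q t $ w (Suc i))"
    by (rule simple_loop_follows_cycle[OF card_C p, folded q_def]) (rule that; assumption)
  have sp: "simple_path p" "pathfinish p = pathstart p" "path_image p = realization C"
    using p by (auto simp: parametrizes_def)
  have contq: "continuous_on A q" for A
    using continuous_on_frac_loop[of p] sp simple_path_imp_path continuous_on_subset
    unfolding q_def by blast
  have q_per: "q (t + 1) = q t" for t by (simp add: q_def)
  have q_inj: "s = t" if "q s = q t" "\<bar>s - t\<bar> < 1" for s t
    using that frac_eq_imp_eq frac_loop_eq_iff[OF sp(1,2)] unfolding q_def by blast
  have "q t \<in> realization C" for t
    using sp(3) frac_lt_1[of t] by (auto simp: q_def path_image_def intro: less_imp_le)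
  then have q_mem: "q t \<in> realization E" for t using C by (auto simp: realization_def)
  have w_mod: "w (i mod k) = w i" for i
  proof -
    have "w (j + m * k) = w j" for j m
      by (induction m) (simp_all add: add.assoc[symmetric] w_per add.commute[of k])
    then show ?thesis by (metis mod_mult_div_eq add.commute mult.commute)
  qed
  have edge: "{w i, w (Suc i)} \<in> E" for i
  proof -
    have "{w (i mod k), w (Suc (i mod k))} \<in> C" using k unfolding C_eq by auto
    moreover have "w (Suc (i mod k)) = w (Suc i)" by (metis mod_Suc_eq w_mod)
    ultimately show ?thesis using C by (auto simp: w_mod)
  qed
  have two_ne: "w i \<noteq> w (Suc (Suc i))" for i
  proof
    assume "w i = w (Suc (Suc i))"
    then have "w (i mod k) = w (Suc (Suc i) mod k)" by (simp add: w_mod)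
    then have "i mod k = Suc (Suc i) mod k" using inj_onD[OF w_inj, of "i mod k" "Suc (Suc i) mod k"] k by auto
    then have "k dvd 2" by (metis add_2_eq_Suc' add_diff_cancel_left' le_add1 mod_eq_dvd_iff_nat)
    then show False using k by (auto dest: dvd_imp_le)
  qed
  have step: "\<tau> i < \<tau> (Suc i)" for i using mono by (simp add: strict_mono_def)

  \<comment> \<open>The bound is \<open>\<mu> / 2\<close> because the corner time used below
    involves two coordinates, each moving by at most the distance. The interval
    \<open>{0..2}\<close> suffices: widths are below 1, and times can be shifted by an
    integer.\<close>
  have "uniformly_continuous_on {0..2} q"
    by (rule compact_uniformly_continuous[OF contq]) simp
  then obtain \<delta> where \<delta>: "0 < \<delta>"
      "\<And>s t. s \<in> {0..2} \<Longrightarrow> t \<in> {0..2} \<Longrightarrow> dist t s < \<delta> \<Longrightarrow> dist (q t) (q s) < \<mu> / 2"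
    unfolding uniformly_continuous_on_def using scale(1) by (metis half_gt_zero)
  define \<nu> where "\<nu> = min (\<delta> / 2) (1 / 2)"
  have \<nu>: "0 < \<nu>" "\<nu> < 1" using \<delta>(1) by (auto simp: \<nu>_def)
  have q_close: "dist (q s) (q t) \<le> \<mu> / 2" if "s < t" "t - s \<le> \<nu>" for s t
  proof -
    have shift: "q (u - of_int \<lfloor>s\<rfloor>) = q u" for u by (simp add: q_def frac_def)
    have "dist (q (t - of_int \<lfloor>s\<rfloor>)) (q (s - of_int \<lfloor>s\<rfloor>)) < \<mu> / 2"
    proof (rule \<delta>(2))
      show "s - of_int \<lfloor>s\<rfloor> \<in> {0..2}" "t - of_int \<lfloor>s\<rfloor> \<in> {0..2}"
        using that \<nu>(2) of_int_floor_le[of s] real_of_int_floor_add_one_gt[of s]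
        unfolding atLeastAtMost_iff by linarith+
      show "dist (t - of_int \<lfloor>s\<rfloor>) (s - of_int \<lfloor>s\<rfloor>) < \<delta>"
        using that \<delta>(1) by (auto simp: dist_real_def \<nu>_def)
    qed
    then show ?thesis by (simp add: shift dist_commute)
  qed
  have coord: "\<bar>x $ j - y $ j\<bar> \<le> dist x y" for x y :: "real ^ 'v" and j
    using component_le_norm_cart[of "x - y" j] by (simp add: dist_norm)

  define d where "d = (\<lambda>t. (f \<circ> p) (frac t))"
  have d: "d t = f (q t)" for t by (simp add: d_def q_def)
  have d_cont: "continuous_on UNIV d"
    unfolding d by (rule continuous_on_compose2[OF cont contq]) (use q_mem in auto)
  have d_inj: "d s \<noteq> d t" if "s < t" "t - s \<le> \<nu>" for s t
  proof -
    have "q s \<noteq> q t" using q_inj[of s t] that \<nu> by auto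
    then show ?thesis
      unfolding d using q_close[OF that] scale(1) by (intro scale(2) q_mem) auto
  qed
  define \<sigma> :: complex where "\<sigma> = (if even (rotation_number (f \<circ> p)) then 1 else -1)"
  obtain S where S: "secant_root d UNIV \<nu> S"
    and S_per: "\<And>s t. s < t \<Longrightarrow> t - s \<le> \<nu> \<Longrightarrow> S (s + 1, t + 1) = \<sigma> * S (s, t)"
    using secant_root_rotation_number[of "f \<circ> p" \<nu>] d_cont \<nu>(1) d_inj unfolding d_def \<sigma>_def by metis

  have "\<forall>i. \<exists>e. e \<in> {1, -1} \<and> (\<forall>s t. (s, t) \<in> secant_domain {\<tau> i..\<tau> (Suc i)} \<nu> \<longrightarrow>
      S (s, t) = e * edge_root (w i) (w (Suc i)) (q s $ w (Suc i), q t $ w (Suc i)))"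
  proof
    fix i
    \<comment> \<open>The coordinate of the far end is the time on the edge. \<open>?J\<close> is
      shorter than a period, so the loop is injective on it, and this time is increasing.\<close>
    let ?J = "{\<tau> i..\<tau> (Suc i)}" and ?\<phi> = "\<lambda>t. q t $ w (Suc i)"
    have "\<tau> (Suc i) < \<tau> (i + k)" using k by (intro strict_monoD[OF mono]) auto
    then have len: "\<tau> (Suc i) - \<tau> i < 1" by (simp add: \<tau>_per)
    have inj: "inj_on ?\<phi> ?J"
    proof (rule inj_onI)
      fix s t assume st: "s \<in> ?J" "t \<in> ?J" "?\<phi> s = ?\<phi> t"
      then have "q s = q t" using on_edge[of i s] on_edge[of i t] by (metis atLeastAtMost_iff)
      then show "s = t" using q_inj st len by auto
    qed
    have ends: "?\<phi> (\<tau> i) < ?\<phi> (\<tau> (Suc i))"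
      using edge_ne[OF edge[of i]] by (simp add: at_\<tau> axis_def)
    have along: "secant_root d ?J \<nu> (\<lambda>(s, t). edge_root (w i) (w (Suc i)) (?\<phi> s, ?\<phi> t))"
    proof (rule secant_root_reparam[OF edge_root[OF edge]])
      show cont\<phi>: "continuous_on ?J ?\<phi>" by (intro continuous_intros contq)
      show "?\<phi> s < ?\<phi> t" if "s \<in> ?J" "t \<in> ?J" "s < t" for s t
        using continuous_injective_imp_increasing[OF cont\<phi> inj ends, of s t] that by auto
      show "?\<phi> t - ?\<phi> s \<le> \<mu>" if "s < t" "t - s \<le> \<nu>" for s t
        using coord[of "q t" "w (Suc i)" "q s"] q_close[OF that] scale(1) by (simp add: dist_commute)
      show "?\<phi> ` ?J \<subseteq> {0..1}" using on_edge by auto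
      show "d t = f (edge_path (w i) (w (Suc i)) (?\<phi> t))" if "t \<in> ?J" for t
        using on_edge[of i t] that by (simp add: d)
    qed
    have "secant_root d ?J \<nu> S" by (rule secant_root_mono[OF S]) auto
    from secant_root_unique[OF convex_real_interval(5) this along] obtain e where "e \<in> {1, -1}" "\<forall>z\<in>secant_domain ?J \<nu>. S z =
        e * (\<lambda>(s, t). edge_root (w i) (w (Suc i)) (?\<phi> s, ?\<phi> t)) z"
      by blast
    then show "\<exists>e. e \<in> {1, -1} \<and> (\<forall>s t. (s, t) \<in> secant_domain ?J \<nu> \<longrightarrow>
        S (s, t) = e * edge_root (w i) (w (Suc i)) (?\<phi> s, ?\<phi> t))"
      by (intro exI[of _ e]) auto
  qed
  from choice[OF this] obtain \<epsilon> where \<epsilon>: "\<And>i. \<epsilon> i \<in> {1, -1}"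
    and S_edge: "\<And>i s t. (s, t) \<in> secant_domain {\<tau> i..\<tau> (Suc i)} \<nu> \<Longrightarrow>
      S (s, t) = \<epsilon> i * edge_root (w i) (w (Suc i)) (q s $ w (Suc i), q t $ w (Suc i))"
    by blast
  have \<epsilon>_eqI: "\<epsilon> i = e" if e: "\<And>s t. (s, t) \<in> secant_domain {\<tau> i..\<tau> (Suc i)} \<nu> \<Longrightarrow>
      S (s, t) = e * edge_root (w i) (w (Suc i)) (q s $ w (Suc i), q t $ w (Suc i))" for i e
  proof -
    have "(\<tau> i, min (\<tau> (Suc i)) (\<tau> i + \<nu>)) \<in> secant_domain {\<tau> i..\<tau> (Suc i)} \<nu>"
      using step[of i] \<nu>(1) by auto
    moreover from this have "S (\<tau> i, min (\<tau> (Suc i)) (\<tau> i + \<nu>)) \<noteq> 0"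
      using secant_rootD(2)[OF S, of "\<tau> i" "min (\<tau> (Suc i)) (\<tau> i + \<nu>)"] by auto
    ultimately show ?thesis using e S_edge by (metis mult_cancel_right mult_zero_right)
  qed

  have turn: "turn (w i) (w (Suc i)) (w (Suc (Suc i))) = \<epsilon> i * \<epsilon> (Suc i)" for i
  proof -
    let ?a = "w i" and ?v = "w (Suc i)" and ?b = "w (Suc (Suc i))"
    \<comment> \<open>\<open>?\<phi>\<close> is the inverse of the corner path from
      \<open>corner_path_coordinate\<close>. Two consecutive edges still take less than a period
      because \<open>3 \<le> k\<close>, so the loop is injective on \<open>?J\<close>.\<close>
    let ?J = "{\<tau> i..\<tau> (Suc (Suc i))}" and ?\<phi> = "\<lambda>t. 1 + q t $ w (Suc (Suc i)) - q t $ w i"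
    have ne: "?a \<noteq> ?v" "?b \<noteq> ?v" "?a \<noteq> ?b"
      using edge_ne[OF edge[of i]] edge_ne[OF edge[of "Suc i"]] two_ne[of i] by auto
    obtain Q e e' where Q: "secant_root (\<lambda>t. f (corner_path ?a ?v ?b t)) {0..2} \<mu> Q"
      and e: "\<And>s t. (s, t)\<in>secant_domain {0..1} \<mu> \<Longrightarrow> Q (s, t) = e * edge_root ?a ?v (s, t)"
        "\<And>s t. (s, t)\<in>secant_domain {0..1} \<mu> \<Longrightarrow> Q (s + 1, t + 1) = e' * edge_root ?v ?b (s, t)"
        "turn ?a ?v ?b = e * e'"
      using corner_sign_turn[OF edge[of i] edge[of "Suc i"] two_ne] unfolding corner_sign_def by blast
    have "\<tau> (Suc (Suc i)) < \<tau> (i + k)" using k by (intro strict_monoD[OF mono]) auto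
    then have len: "\<tau> (Suc (Suc i)) - \<tau> i < 1" by (simp add: \<tau>_per)
    have \<phi>1: "?\<phi> t = q t $ ?v" "q t = edge_path ?a ?v (?\<phi> t)" "?\<phi> t \<in> {0..1}"
      if "\<tau> i \<le> t" "t \<le> \<tau> (Suc i)" for t
    proof -
      have "q t = edge_path ?a ?v (q t $ ?v)" using on_edge[OF that] by blast
      then have eq: "q t $ j = edge_path ?a ?v (q t $ ?v) $ j" for j by (rule arg_cong)
      have "q t $ ?b = 0" "q t $ ?a = 1 - q t $ ?v"
        using eq[of ?b] eq[of ?a] ne by (simp_all add: edge_path_nth)
      then show "?\<phi> t = q t $ ?v" by simp
      then show "q t = edge_path ?a ?v (?\<phi> t)" "?\<phi> t \<in> {0..1}" using on_edge[OF that] by auto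
    qed
    have \<phi>2: "?\<phi> t = q t $ ?b + 1" "q t = edge_path ?v ?b (?\<phi> t - 1)" "?\<phi> t \<in> {1..2}"
      if "\<tau> (Suc i) \<le> t" "t \<le> \<tau> (Suc (Suc i))" for t
    proof -
      have "q t = edge_path ?v ?b (q t $ ?b)" using on_edge[OF that] by blast
      then have "q t $ j = edge_path ?v ?b (q t $ ?b) $ j" for j by (rule arg_cong)
      from this[of ?a] have "q t $ ?a = 0" using ne by (simp add: edge_path_nth)
      then show "?\<phi> t = q t $ ?b + 1" by simp
      then show "q t = edge_path ?v ?b (?\<phi> t - 1)" "?\<phi> t \<in> {1..2}" using on_edge[OF that] by auto
    qed
    have path: "q t = corner_path ?a ?v ?b (?\<phi> t) \<and> ?\<phi> t \<in> {0..2}" if "t \<in> ?J" for t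
    proof (cases "t \<le> \<tau> (Suc i)")
      case True
      then show ?thesis using \<phi>1[of t] that by (auto simp: corner_path_def)
    next
      case False
      then show ?thesis using \<phi>2[of t] that by (auto simp: corner_path_second)
    qed
    have inj: "inj_on ?\<phi> ?J"
    proof (rule inj_onI)
      fix s t assume st: "s \<in> ?J" "t \<in> ?J" "?\<phi> s = ?\<phi> t"
      then have "q s = q t" using path by metis
      then show "s = t" using q_inj st len by auto
    qed
    have ends: "?\<phi> (\<tau> i) < ?\<phi> (\<tau> (Suc (Suc i)))"
      using ne by (simp add: at_\<tau> axis_def)
    have cont\<phi>: "continuous_on ?J ?\<phi>" by (intro continuous_intros contq)
    have incr: "?\<phi> s < ?\<phi> t \<and> ?\<phi> t - ?\<phi> s \<le> \<mu>" if "(s, t) \<in> secant_domain ?J \<nu>" for s t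
    proof
      show "?\<phi> s < ?\<phi> t"
        using continuous_injective_imp_increasing[OF cont\<phi> inj ends, of s t] that by auto
      show "?\<phi> t - ?\<phi> s \<le> \<mu>"
        using coord[of "q s" ?a "q t"] coord[of "q s" ?b "q t"] q_close[of s t] that by auto
    qed
    have along: "secant_root d ?J \<nu> (\<lambda>(s, t). Q (?\<phi> s, ?\<phi> t))"
    proof (rule secant_root_reparam[OF Q cont\<phi>])
      show "?\<phi> s < ?\<phi> t" if "s \<in> ?J" "t \<in> ?J" "s < t" for s t
        using continuous_injective_imp_increasing[OF cont\<phi> inj ends, of s t] that by auto
      show "?\<phi> t - ?\<phi> s \<le> \<mu>" if "s \<in> ?J" "t \<in> ?J" "s < t" "t - s \<le> \<nu>" for s t
        using incr[of s t] that by auto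
      show "?\<phi> ` ?J \<subseteq> {0..2}" using path by blast
      show "d t = f (corner_path ?a ?v ?b (?\<phi> t))" if "t \<in> ?J" for t
        using path[OF that] by (simp add: d)
    qed
    have "secant_root d ?J \<nu> S" by (rule secant_root_mono[OF S]) auto
    from secant_root_unique[OF convex_real_interval(5) this along] obtain c where c: "c \<in> {1, -1}"
        "\<And>s t. (s, t) \<in> secant_domain ?J \<nu> \<Longrightarrow> S (s, t) = c * Q (?\<phi> s, ?\<phi> t)"
      by (metis (no_types, lifting) case_prod_conv)
    \<comment> \<open>On each half of the corner \<open>S\<close> is \<open>c\<close> times the
      pulled-back \<open>Q\<close>, and \<open>Q\<close> is \<open>e\<close> or \<open>e'\<close>
      times the edge root. In the product of the two signs \<open>c\<close> cancels.\<close>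
    have "\<epsilon> i = c * e"
    proof (rule \<epsilon>_eqI)
      fix s t assume st: "(s, t) \<in> secant_domain {\<tau> i..\<tau> (Suc i)} \<nu>"
      then have J: "(s, t) \<in> secant_domain ?J \<nu>" using step[of "Suc i"] by auto
      have "(?\<phi> s, ?\<phi> t) \<in> secant_domain {0..1} \<mu>"
        using \<phi>1(3)[of s] \<phi>1(3)[of t] st incr[OF J] by auto
      then show "S (s, t) = c * e * edge_root ?a ?v (q s $ ?v, q t $ ?v)"
        using c(2)[OF J] e(1) \<phi>1(1)[of s] \<phi>1(1)[of t] st by auto
    qed
    moreover have "\<epsilon> (Suc i) = c * e'"
    proof (rule \<epsilon>_eqI)
      fix s t assume st: "(s, t) \<in> secant_domain {\<tau> (Suc i)..\<tau> (Suc (Suc i))} \<nu>"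
      then have J: "(s, t) \<in> secant_domain ?J \<nu>" using step[of i] by auto
      have \<phi>: "?\<phi> s = q s $ ?b + 1" "?\<phi> t = q t $ ?b + 1"
        using \<phi>2(1)[of s] \<phi>2(1)[of t] st by auto
      have "(q s $ ?b, q t $ ?b) \<in> secant_domain {0..1} \<mu>"
        using \<phi>2(3)[of s] \<phi>2(3)[of t] st incr[OF J] unfolding \<phi> by auto
      then have "Q (q s $ ?b + 1, q t $ ?b + 1) = e' * edge_root ?v ?b (q s $ ?b, q t $ ?b)"
        by (rule e(2))
      then show "S (s, t) = c * e' * edge_root ?v ?b (q s $ ?b, q t $ ?b)"
        using c(2)[OF J] unfolding \<phi> by simp
    qed
    ultimately show ?thesis using c(1) e(3) by auto
  qed

  have telescope: "(\<Prod>i<m. turn (w i) (w (Suc i)) (w (Suc (Suc i)))) = \<epsilon> 0 * \<epsilon> m" for m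
  proof (induction m)
    case 0 then show ?case using \<epsilon>[of 0] by auto
  next
    case (Suc m) then show ?case using \<epsilon>[of m] by (auto simp: turn)
  qed
  \<comment> \<open>A full period takes the first time interval to the one numbered
    \<open>k\<close>, over which the loop runs through the same edge; \<open>S\<close> changes by
    \<open>\<sigma>\<close>, the edge root does not change.\<close>
  have "\<epsilon> 0 = \<sigma> * \<epsilon> k"
  proof (rule \<epsilon>_eqI)
    fix s t assume st: "(s, t) \<in> secant_domain {\<tau> 0..\<tau> (Suc 0)} \<nu>"
    have "(s + 1, t + 1) \<in> secant_domain {\<tau> k..\<tau> (Suc k)} \<nu>"
      using st \<tau>_per[of 0] \<tau>_per[of "Suc 0"] by auto
    then have "S (s + 1, t + 1) = \<epsilon> k * edge_root (w 0) (w (Suc 0)) (q s $ w (Suc 0), q t $ w (Suc 0))"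
      using S_edge[of "s + 1" "t + 1" k] w_per[of 0] w_per[of "Suc 0"] by (simp add: q_per)
    moreover have "S (s + 1, t + 1) = \<sigma> * S (s, t)" using S_per st by simp
    moreover have "\<sigma> * \<sigma> = 1" by (simp add: \<sigma>_def)
    ultimately show "S (s, t) = \<sigma> * \<epsilon> k * edge_root (w 0) (w (Suc 0)) (q s $ w (Suc 0), q t $ w (Suc 0))"
      by (metis mult.assoc mult_1)
  qed
  then have "\<sigma> = (\<Prod>i<k. turn (w i) (w (Suc i)) (w (Suc (Suc i))))"
    unfolding telescope using \<epsilon>[of k] by auto
  then show ?thesis using that k w_per w_inj C_eq cardC unfolding \<sigma>_def by blast
qed

end

section \<open>Canonical cyclic sequences\<close>

text \<open>Infinite periodic sequences replace lists here: rotating and reversing a cycle become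
  arithmetic on indices, without a seam.\<close>

definition cyclic_seq :: "nat \<Rightarrow> (nat \<Rightarrow> 'a) \<Rightarrow> bool" where
  "cyclic_seq k w \<longleftrightarrow> (\<forall>i j. w i = w j \<longleftrightarrow> i mod k = j mod k)"

definition seq_edges :: "(nat \<Rightarrow> 'a) \<Rightarrow> 'a set set" where
  "seq_edges w = range (\<lambda>i. {w i, w (Suc i)})"

text \<open>A cycle of length \<open>k\<close> is described by \<open>2 * k\<close> sequences. The
  start of least rank and the direction whose second vertex has the smaller rank select one of
  them.\<close>

definition canonical_seq :: "('a \<Rightarrow> nat) \<Rightarrow> nat \<Rightarrow> (nat \<Rightarrow> 'a) \<Rightarrow> bool" where
  "canonical_seq rk k w \<longleftrightarrow>
     cyclic_seq k w \<and> (\<forall>i. rk (w 0) \<le> rk (w i)) \<and> rk (w 1) < rk (w (k - 1))"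

lemma mod_add_cancel_nat:
  "(i + m) mod k = (j + m) mod k \<longleftrightarrow> i mod k = j mod k"
  "(m + i) mod k = (m + j) mod k \<longleftrightarrow> i mod k = j mod k" for i j k m :: nat
  using cong_add_rcancel_nat[of i m j k] cong_add_lcancel_nat[of m i j k] by (simp_all add: cong_def)

lemma cyclic_seqD: "cyclic_seq k w \<Longrightarrow> w i = w j \<longleftrightarrow> i mod k = j mod k"
  by (simp add: cyclic_seq_def)

lemma seq_edges_conv_period:
  assumes w: "cyclic_seq k w" and k: "0 < k"
  shows "seq_edges w = (\<lambda>i. {w i, w (Suc i)}) ` {..<k}"
proof -
  have "{w i, w (Suc i)} \<in> (\<lambda>i. {w i, w (Suc i)}) ` {..<k}" for i
  proof
    show "{w i, w (Suc i)} = {w (i mod k), w (Suc (i mod k))}"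
      using cyclic_seqD[OF w, of i "i mod k"] cyclic_seqD[OF w, of "Suc i" "Suc (i mod k)"]
      by (simp add: mod_Suc_eq)
  qed (use k in simp)
  then show ?thesis unfolding seq_edges_def by auto
qed

text \<open>\<open>h\<close> is injective on residues modulo \<open>k\<close>, hence permutes
  them.\<close>

lemma prod_periodic_reindex:
  fixes g :: "nat \<Rightarrow> 'b::comm_monoid_mult"
  assumes k: "0 < k" and per: "\<And>i j. i mod k = j mod k \<Longrightarrow> g i = g j"
    and inj: "\<And>i j. h i mod k = h j mod k \<Longrightarrow> i mod k = j mod k"
  shows "(\<Prod>i<k. g (h i)) = (\<Prod>i<k. g i)"
proof -
  have "inj_on (\<lambda>i. h i mod k) {..<k}"
    using inj by (intro inj_onI) (metis lessThan_iff mod_less)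
  moreover have "(\<lambda>i. h i mod k) ` {..<k} \<subseteq> {..<k}" using k by auto
  ultimately have "bij_betw (\<lambda>i. h i mod k) {..<k} {..<k}"
    by (simp add: bij_betw_def endo_inj_surj)
  then have "(\<Prod>i<k. g (h i mod k)) = (\<Prod>i<k. g i)" by (rule prod.reindex_bij_betw)
  moreover have "g (h i mod k) = g (h i)" for i by (rule per) simp
  ultimately show ?thesis by simp
qed

text \<open>Modulo \<open>Suc n\<close>, multiplication by \<open>n\<close> is negation and thus an
  involution; it expresses reversal without subtracting natural numbers.\<close>

lemma mult_pred_pred_mod: "n * (n * i) mod Suc n = i mod Suc n"
proof (cases n)
  case (Suc m)
  have "n * (n * i) = i + (m * i) * Suc n" by (simp add: Suc algebra_simps)
  then show ?thesis by (metis mod_mult_self1)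
qed simp

lemma mult_pred_mod_cancel:
  assumes "(n * i) mod Suc n = (n * j) mod Suc n"
  shows "i mod Suc n = j mod Suc n"
  by (metis assms mod_mult_right_eq mult_pred_pred_mod)

text \<open>\<open>u\<close> reads \<open>w\<close> backwards, at index \<open>- i\<close> modulo
  \<open>Suc n\<close>. With \<open>j = n * Suc (Suc i)\<close>, the three values of
  \<open>u\<close> from \<open>i\<close> on are those of \<open>w\<close> at \<open>j + 2\<close>,
  \<open>j + 1\<close> and \<open>j\<close>.\<close>

lemma reversed_seq:
  assumes w: "cyclic_seq (Suc n) w"
  defines "u \<equiv> \<lambda>i. w (n * i)"
  shows "cyclic_seq (Suc n) u" "seq_edges u = seq_edges w"
    "u (Suc i) = w (n * Suc (Suc i) + 1)" "u i = w (n * Suc (Suc i) + 2)"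
proof -
  have per: "w i = w (i + m * Suc n)" for i m
    using cyclic_seqD[OF w, of i "i + m * Suc n"] by (simp only: mod_mult_self1)
  have shift: "v (n * Suc i + 1) = v (n * i)" if "cyclic_seq (Suc n) v" for v :: "nat \<Rightarrow> 'a" and i
    using cyclic_seqD[OF that, of "n * Suc i + 1" "n * i"]
    by (metis Suc_eq_plus1 add.assoc add.commute mod_add_self2 mult_Suc_right)
  have sub: "seq_edges (\<lambda>i. v (n * i)) \<subseteq> seq_edges v" if v: "cyclic_seq (Suc n) v" for v :: "nat \<Rightarrow> 'a"
  proof -
    have "{v (n * i), v (n * Suc i)} \<in> seq_edges v" for i
      unfolding seq_edges_def using shift[OF v, of i]
      by (intro range_eqI[of _ _ "n * Suc i"]) (simp add: insert_commute)
    then show ?thesis unfolding seq_edges_def by auto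
  qed
  show u: "cyclic_seq (Suc n) u"
    unfolding cyclic_seq_def u_def cyclic_seqD[OF w]
    by (metis mult_pred_mod_cancel mod_mult_right_eq)
  have "(\<lambda>i. u (n * i)) = w"
    unfolding u_def using cyclic_seqD[OF w] mult_pred_pred_mod by blast
  then show "seq_edges u = seq_edges w"
    using sub[OF u] sub[OF w] unfolding u_def by auto
  show "u (Suc i) = w (n * Suc (Suc i) + 1)"
    unfolding u_def by (rule shift[OF w, symmetric])
  have eq: "n * Suc (Suc i) + 2 = n * i + 2 * Suc n" by simp
  show "u i = w (n * Suc (Suc i) + 2)"
    unfolding u_def eq by (rule per)
qed

text \<open>Moving the start to the vertex of least rank permutes the factors. If the direction is
  then wrong, reversal negates every factor, and the signs cancel because \<open>k\<close> is
  even.\<close>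

lemma canonical_seq_exists:
  fixes T :: "'a \<Rightarrow> 'a \<Rightarrow> 'a \<Rightarrow> complex"
  assumes w: "cyclic_seq k w" and k: "3 \<le> k" "even k" and rk: "inj rk"
    and T: "\<And>i. T (w (Suc (Suc i))) (w (Suc i)) (w i) = - T (w i) (w (Suc i)) (w (Suc (Suc i)))"
  obtains u where "canonical_seq rk k u" "seq_edges u = seq_edges w"
    "(\<Prod>i<k. T (u i) (u (Suc i)) (u (Suc (Suc i)))) = (\<Prod>i<k. T (w i) (w (Suc i)) (w (Suc (Suc i))))"
proof -
  define G where "G i = T (w i) (w (Suc i)) (w (Suc (Suc i)))" for i
  have G_per: "G i = G j" if "i mod k = j mod k" for i j
  proof -
    have "w (m + i) = w (m + j)" for m
      using that cyclic_seqD[OF w] by (metis mod_add_cong)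
    from this[of 0] this[of 1] this[of 2] show ?thesis by (simp add: G_def numeral_2_eq_2)
  qed
  obtain m where m: "\<And>i. rk (w m) \<le> rk (w i)"
    using ex_has_least_nat[of "\<lambda>_. True" 0 "\<lambda>i. rk (w i)"] by auto
  define v where "v i = w (i + m)" for i
  have v: "cyclic_seq k v"
    unfolding cyclic_seq_def v_def cyclic_seqD[OF w] by (simp add: mod_add_cancel_nat)
  have v_edges: "seq_edges v = seq_edges w"
  proof
    show "seq_edges v \<subseteq> seq_edges w" by (auto simp: seq_edges_def v_def)
    show "seq_edges w \<subseteq> seq_edges v"
    proof
      fix e assume "e \<in> seq_edges w"
      then obtain i where i: "e = {w i, w (Suc i)}" by (auto simp: seq_edges_def)
      \<comment> \<open>A multiple of the period is added so that \<open>m\<close> can be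
        subtracted.\<close>
      have "m \<le> i + m * k" using k(1) by (cases k) auto
      then obtain j where j: "j + m = i + m * k" using le_add_diff_inverse2 by blast
      have "w (j + m) = w i" "w (Suc j + m) = w (Suc i)"
        unfolding cyclic_seqD[OF w] using j by (metis mod_mult_self1 add_Suc)+
      then show "e \<in> seq_edges v"
        unfolding i seq_edges_def v_def by (intro range_eqI[of _ _ j]) simp
    qed
  qed
  have v_prod: "(\<Prod>i<k. T (v i) (v (Suc i)) (v (Suc (Suc i)))) = (\<Prod>i<k. G i)"
  proof -
    have "(\<Prod>i<k. G (i + m)) = (\<Prod>i<k. G i)"
      using k(1) by (intro prod_periodic_reindex[OF _ G_per]) (simp_all add: mod_add_cancel_nat)
    then show ?thesis by (simp add: G_def v_def)
  qed
  have v_min: "rk (v 0) \<le> rk (v i)" for i using m by (simp add: v_def)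
  obtain n where n: "k = Suc n" using k(1) by (cases k) auto
  show ?thesis
  proof (cases "rk (v 1) < rk (v (k - 1))")
    case True
    then show ?thesis
      using that[of v] v v_edges v_prod v_min unfolding canonical_seq_def G_def by blast
  next
    case False
    have "v 1 \<noteq> v (k - 1)" using cyclic_seqD[OF v, of 1 "k - 1"] k(1) by auto
    then have lt: "rk (v n) < rk (v 1)"
      using False rk n by (metis diff_Suc_1 injD linorder_less_linear)
    define u where "u i = v (n * i)" for i
    have "(\<lambda>i. v (n * i)) = u" by (simp add: u_def fun_eq_iff)
    note rev = reversed_seq[OF v[unfolded n], unfolded this]
    have u_last: "u n = v 1"
      unfolding u_def cyclic_seqD[OF v] n using mult_pred_pred_mod[of n 1] by simp
    have "canonical_seq rk k u"
      unfolding canonical_seq_def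
      using rev(1) v_min lt u_last by (simp add: n u_def)
    moreover have "seq_edges u = seq_edges w" using rev(2) v_edges by simp
    moreover have "(\<Prod>i<k. T (u i) (u (Suc i)) (u (Suc (Suc i)))) = (\<Prod>i<k. G i)"
    proof -
      define H where "H i = T (v i) (v (Suc i)) (v (Suc (Suc i)))" for i
      have H: "H i = G (i + m)" for i by (simp add: H_def G_def v_def)
      have "T (u i) (u (Suc i)) (u (Suc (Suc i))) = - H (n * Suc (Suc i))" for i
      proof -
        define j where "j = n * Suc (Suc i)"
        have "u i = v (Suc (Suc j))" "u (Suc i) = v (Suc j)" "u (Suc (Suc i)) = v j"
          using rev(3,4)[of i] by (simp_all add: j_def u_def)
        then show ?thesis using T[of "j + m"] unfolding j_def[symmetric] by (simp add: H_def v_def)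
      qed
      then have "(\<Prod>i<k. T (u i) (u (Suc i)) (u (Suc (Suc i)))) = (\<Prod>i<k. - H (n * Suc (Suc i)))"
        by simp
      also have "\<dots> = (\<Prod>i<k. H (n * Suc (Suc i)))"
        using k(2) by (simp add: prod_uminus)
      also have "\<dots> = (\<Prod>i<k. H i)"
      proof (rule prod_periodic_reindex)
        show "H i = H j" if "i mod k = j mod k" for i j
          unfolding H using that by (intro G_per) (metis mod_add_cong)
        show "i mod k = j mod k" if "(n * Suc (Suc i)) mod k = (n * Suc (Suc j)) mod k" for i j
        proof -
          have "(i + 2) mod k = (j + 2) mod k"
            using mult_pred_mod_cancel[of n "Suc (Suc i)" "Suc (Suc j)"] that by (simp add: n)
          then show ?thesis by (simp only: mod_add_cancel_nat)
        qed
      qed (use k in simp)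
      also have "\<dots> = (\<Prod>i<k. G i)" using v_prod by (simp add: H_def)
      finally show ?thesis .
    qed
    ultimately show ?thesis using that unfolding G_def by blast
  qed
qed

text \<open>\<open>i + k - 1\<close> stands for the predecessor of \<open>i\<close>, which keeps the
  index natural when \<open>i = 0\<close>.\<close>

lemma seq_edges_neighbour:
  assumes w: "cyclic_seq k w" and k: "0 < k" and e: "{w i, x} \<in> seq_edges w"
  shows "x = w (Suc i) \<or> x = w (i + k - 1)"
proof -
  obtain j where "{w i, x} = {w j, w (Suc j)}" using e by (auto simp: seq_edges_def)
  then consider "w i = w j" "x = w (Suc j)" | "w i = w (Suc j)" "x = w j"
    by (auto simp: doubleton_eq_iff)
  then show ?thesis
  proof cases
    case 1
    then have "w (Suc j) = w (Suc i)"
      using cyclic_seqD[OF w] by (metis mod_Suc_eq)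
    then show ?thesis using 1 by simp
  next
    case 2
    then have "i mod k = Suc j mod k" using cyclic_seqD[OF w] by blast
    then have "(i + (k - 1)) mod k = (Suc j + (k - 1)) mod k" by (metis mod_add_cong)
    also have "Suc j + (k - 1) = j + k" using k by simp
    finally have "w j = w (i + k - 1)" using k by (simp add: cyclic_seqD[OF w])
    then show ?thesis using 2 by simp
  qed
qed

text \<open>Both sequences start at the vertex of least rank, and the rank condition fixes the
  direction. From there each next vertex is the neighbour that was not just visited.\<close>

lemma canonical_seq_unique:
  assumes u: "canonical_seq rk k u" and w: "canonical_seq rk k w" and k: "3 \<le> k" and rk: "inj rk"
    and edges: "seq_edges u = seq_edges w"
  shows "u = w"
proof -
  have cu: "cyclic_seq k u" and cw: "cyclic_seq k w" using u w by (auto simp: canonical_seq_def)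
  have verts: "range v = \<Union>(seq_edges v)" for v :: "nat \<Rightarrow> 'a" by (auto simp: seq_edges_def)
  have zero: "u 0 = w 0"
  proof -
    have "range u = range w" using verts[of u] verts[of w] edges by simp
    then obtain i j where "u 0 = w i" "w 0 = u j" by (metis rangeE rangeI)
    then have "rk (u 0) = rk (w 0)"
      using u w unfolding canonical_seq_def by (metis order_antisym)
    then show ?thesis using rk by (simp add: inj_eq)
  qed
  have in_w: "{u i, u (Suc i)} \<in> seq_edges w" for i
    using edges by (auto simp: seq_edges_def)
  have last: "u (Suc (k - 1)) = u 0" using cyclic_seqD[OF cu] k by simp
  have n1: "u 1 = w 1 \<or> u 1 = w (k - 1)"
    using seq_edges_neighbour[OF cw, of 0 "u 1"] in_w[of 0] zero k by auto
  have n2: "u (k - 1) = w 1 \<or> u (k - 1) = w (k - 1)"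
    using seq_edges_neighbour[OF cw, of 0 "u (k - 1)"] in_w[of "k - 1"] zero k last
    by (auto simp: insert_commute)
  have one: "u 1 = w 1"
  proof (rule ccontr)
    assume "u 1 \<noteq> w 1"
    then have "u 1 = w (k - 1)" using n1 by blast
    moreover have "u 1 \<noteq> u (k - 1)" using cyclic_seqD[OF cu] k by simp
    ultimately have "u (k - 1) = w 1" using n2 by metis
    then show False using \<open>u 1 = w (k - 1)\<close> u w by (simp add: canonical_seq_def)
  qed
  have "u i = w i \<and> u (Suc i) = w (Suc i)" for i
  proof (induction i)
    case 0 then show ?case using zero one by simp
  next
    case (Suc i)
    have "u (Suc (Suc i)) = w (Suc (Suc i)) \<or> u (Suc (Suc i)) = w (Suc i + k - 1)"
      using seq_edges_neighbour[OF cw, of "Suc i"] in_w[of "Suc i"] Suc k by auto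
    moreover have "w (Suc i + k - 1) = u i"
      using cyclic_seqD[OF cw, of "Suc i + k - 1" i] Suc by simp
    moreover have "u i \<noteq> u (Suc (Suc i))"
    proof
      assume "u i = u (Suc (Suc i))"
      then have "(0 + i) mod k = (2 + i) mod k" using cyclic_seqD[OF cu, of i "Suc (Suc i)"] by simp
      then have "0 mod k = 2 mod k" by (simp only: mod_add_cancel_nat)
      then show False using k by simp
    qed
    ultimately show ?case using Suc by metis
  qed
  then show ?thesis by blast
qed

section \<open>Cycles as lists of vertices, prepared for enumeration\<close>

definition canonical_cycles :: "('a \<Rightarrow> 'a \<Rightarrow> bool) \<Rightarrow> ('a \<Rightarrow> nat) \<Rightarrow> nat \<Rightarrow> 'a list set" where
  "canonical_cycles adj rk k =
     {vs. length vs = k \<and> distinct vs \<and> successively adj vs \<and> adj (last vs) (hd vs) \<and>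
          (\<forall>x\<in>set (tl vs). rk (hd vs) < rk x) \<and> rk (vs ! 1) < rk (last vs)}"

lemma list_of_cyclic_seq:
  assumes w: "cyclic_seq k w" and k: "3 \<le> k"
  shows "distinct (map w [0..<k])" "cycle_edges (map w [0..<k]) = seq_edges w"
proof -
  show "distinct (map w [0..<k])"
    unfolding distinct_map by (auto simp: inj_on_def cyclic_seqD[OF w])
  have "cycle_edges (map w [0..<k]) =
      (\<lambda>i. {map w [0..<k] ! i, map w [0..<k] ! (Suc i mod k)}) ` {..<k}"
    using cycle_edges_conv_nth[of "map w [0..<k]"] k by simp
  also have "\<dots> = (\<lambda>i. {w i, w (Suc i)}) ` {..<k}"
  proof (rule image_cong[OF refl])
    fix i assume "i \<in> {..<k}"
    moreover have "w (Suc i mod k) = w (Suc i)" by (simp add: cyclic_seqD[OF w])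
    ultimately show "{map w [0..<k] ! i, map w [0..<k] ! (Suc i mod k)} = {w i, w (Suc i)}"
      using k by simp
  qed
  finally show "cycle_edges (map w [0..<k]) = seq_edges w"
    using seq_edges_conv_period[OF w] k by simp
qed

text \<open>The list is one period of the sequence. Injectivity of \<open>rk\<close> turns the weak
  minimality of the first term into the strict one required against the tail of the list.\<close>

lemma canonical_cycles_iff_seq:
  assumes k: "3 \<le> k" and rk: "inj rk" and adj: "\<And>x y. adj x y \<longleftrightarrow> {x, y} \<in> E"
  shows "vs \<in> canonical_cycles adj rk k \<longleftrightarrow>
    (\<exists>w. vs = map w [0..<k] \<and> canonical_seq rk k w \<and> seq_edges w \<subseteq> E)"
proof
  assume "\<exists>w. vs = map w [0..<k] \<and> canonical_seq rk k w \<and> seq_edges w \<subseteq> E"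
  then obtain w where vs: "vs = map w [0..<k]" and w: "canonical_seq rk k w" and E: "seq_edges w \<subseteq> E"
    by blast
  have cw: "cyclic_seq k w" using w by (simp add: canonical_seq_def)
  have nth: "vs ! i = w i" if "i < k" for i using that vs by simp
  have len: "length vs = k" and ne: "vs \<noteq> []" using vs k by auto
  have hd: "hd vs = w 0" and last: "last vs = w (k - 1)"
    using k ne len nth by (simp_all add: hd_conv_nth last_conv_nth)
  have adjw: "adj (w i) (w (Suc i))" for i using E by (auto simp: adj seq_edges_def)
  have "successively adj vs"
    using adjw nth len by (simp add: successively_conv_nth)
  moreover have "adj (last vs) (hd vs)"
    using adjw[of "k - 1"] cyclic_seqD[OF cw, of k 0] k unfolding hd last by simp
  moreover have "rk (hd vs) < rk x" if "x \<in> set (tl vs)" for x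
  proof -
    obtain i where "i < length (tl vs)" "x = tl vs ! i" using \<open>x \<in> set (tl vs)\<close> by (metis in_set_conv_nth)
    then have i: "Suc i < k" "x = w (Suc i)" using nth len by (auto simp: nth_tl)
    have "w 0 \<noteq> x" using cyclic_seqD[OF cw, of 0 "Suc i"] i by simp
    then have "rk (w 0) \<noteq> rk x" using rk by (simp add: inj_eq)
    moreover have "rk (w 0) \<le> rk x" using w i(2) by (simp add: canonical_seq_def)
    ultimately show ?thesis unfolding hd by simp
  qed
  moreover have "rk (vs ! 1) < rk (last vs)"
    using w nth[of 1] k unfolding last by (simp add: canonical_seq_def)
  ultimately show "vs \<in> canonical_cycles adj rk k"
    using list_of_cyclic_seq(1)[OF cw k] len unfolding canonical_cycles_def vs by blast
next
  assume "vs \<in> canonical_cycles adj rk k"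
  then have len: "length vs = k" and dist: "distinct vs" and succ: "successively adj vs"
    and close: "adj (last vs) (hd vs)" and min: "\<And>x. x \<in> set (tl vs) \<Longrightarrow> rk (hd vs) < rk x"
    and dir: "rk (vs ! 1) < rk (last vs)"
    by (auto simp: canonical_cycles_def)
  have ne: "vs \<noteq> []" using len k by auto
  define w where "w i = vs ! (i mod k)" for i
  have cw: "cyclic_seq k w"
    unfolding cyclic_seq_def w_def using dist len k by (simp add: nth_eq_iff_index_eq)
  have vs: "vs = map w [0..<k]"
    using len by (intro nth_equalityI) (auto simp: w_def)
  have "adj (w i) (w (Suc i))" for i
  proof (cases "Suc (i mod k) = k")
    case True
    then have "Suc i mod k = 0" by (simp add: mod_Suc)
    moreover have "i mod k = k - 1" using True by simp
    ultimately show ?thesis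
      using close ne len by (simp add: w_def hd_conv_nth last_conv_nth)
  next
    case False
    then have "Suc i mod k = Suc (i mod k)" by (simp add: mod_Suc)
    moreover have "Suc (i mod k) < k" using False k mod_less_divisor[of k i] by linarith
    ultimately show ?thesis
      using succ len by (simp add: w_def successively_conv_nth)
  qed
  then have E: "seq_edges w \<subseteq> E" by (auto simp: seq_edges_def adj)
  have "rk (w 0) \<le> rk (w i)" for i
  proof (cases "i mod k")
    case 0 then show ?thesis by (simp add: w_def)
  next
    case (Suc j)
    then have "Suc j < k" using k mod_less_divisor[of k i] by simp
    then have j: "j < length (tl vs)" using len by simp
    have "w i = tl vs ! j" using nth_tl[OF j] Suc by (simp add: w_def)
    then have "w i \<in> set (tl vs)" using nth_mem[OF j] by simp
    moreover have "hd vs = w 0" using ne by (simp add: w_def hd_conv_nth)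
    ultimately show ?thesis using min by fastforce
  qed
  moreover have "rk (w 1) < rk (w (k - 1))"
    using dir ne len k by (simp add: w_def last_conv_nth)
  ultimately show "\<exists>w. vs = map w [0..<k] \<and> canonical_seq rk k w \<and> seq_edges w \<subseteq> E"
    using vs cw E unfolding canonical_seq_def by blast
qed

fun walk_triples :: "'a list \<Rightarrow> ('a \<times> 'a \<times> 'a) list" where
  "walk_triples (a # b # c # r) = (a, b, c) # walk_triples (b # c # r)"
| "walk_triples _ = []"

text \<open>Repeating the first two vertices supplies the two corners across the seam of the
  list.\<close>

definition cycle_triples :: "'a list \<Rightarrow> ('a \<times> 'a \<times> 'a) list" where
  "cycle_triples vs = walk_triples (vs @ take 2 vs)"

lemma walk_triples_map: "walk_triples (map f vs) = map (map_prod f (map_prod f f)) (walk_triples vs)"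
  by (induction vs rule: walk_triples.induct) auto

lemma cycle_triples_map: "cycle_triples (map f vs) = map (map_prod f (map_prod f f)) (cycle_triples vs)"
  unfolding cycle_triples_def by (simp flip: walk_triples_map add: take_map)

lemma walk_triples_seq:
  "walk_triples (map w [m..<Suc (Suc (m + n))]) = map (\<lambda>i. (w i, w (Suc i), w (Suc (Suc i)))) [m..<m + n]"
proof (induction n arbitrary: m)
  case (Suc n)
  have "[m..<Suc (Suc (m + Suc n))] = m # Suc m # Suc (Suc m) # [Suc (Suc (Suc m))..<Suc (Suc (m + Suc n))]"
    by (simp add: upt_conv_Cons)
  moreover have "[Suc m..<Suc (Suc (Suc m + n))] = Suc m # Suc (Suc m) # [Suc (Suc (Suc m))..<Suc (Suc (m + Suc n))]"
    by (simp add: upt_conv_Cons)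
  moreover have "[m..<m + Suc n] = m # [Suc m..<Suc m + n]" by (simp add: upt_conv_Cons)
  ultimately show ?case using Suc[of "Suc m"] by simp
qed (simp add: upt_conv_Cons)

lemma cycle_triples_seq:
  assumes w: "cyclic_seq k w" and k: "3 \<le> k"
  shows "cycle_triples (map w [0..<k]) = map (\<lambda>i. (w i, w (Suc i), w (Suc (Suc i)))) [0..<k]"
proof -
  have "[0..<k] = 0 # 1 # [2..<k]" using k by (simp add: upt_conv_Cons numeral_2_eq_2)
  then have "take 2 (map w [0..<k]) = [w 0, w 1]" by (simp add: numeral_2_eq_2)
  also have "\<dots> = map w [k, Suc k]"
    using cyclic_seqD[OF w, of 0 k] cyclic_seqD[OF w, of 1 "Suc k"] k by (simp add: mod_Suc)
  finally have "map w [0..<k] @ take 2 (map w [0..<k]) = map w [0..<Suc (Suc (0 + k))]" by simp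
  then show ?thesis unfolding cycle_triples_def using walk_triples_seq[of w 0 k] by simp
qed

text \<open>Depth-first enumeration of walks with \<open>n\<close> steps from \<open>v\<close>;
  \<open>av\<close> holds the vertices still allowed. In its use below \<open>av\<close> is distinct
  and excludes \<open>v\<close>, so the walks are self-avoiding.\<close>

fun paths :: "('a \<Rightarrow> 'a list) \<Rightarrow> nat \<Rightarrow> 'a list \<Rightarrow> 'a \<Rightarrow> 'a list list" where
  "paths nbs 0 av v = [[v]]"
| "paths nbs (Suc n) av v =
     concat (map (\<lambda>x. map ((#) v) (paths nbs n (remove1 x av) x)) (filter (\<lambda>x. x \<in> set av) (nbs v)))"

lemma set_paths:
  "distinct av \<Longrightarrow> set (paths nbs n av v) =
     {v # us |us. length us = n \<and> distinct us \<and> set us \<subseteq> set av \<and> successively (\<lambda>x y. y \<in> set (nbs x)) (v # us)}"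
proof (induction n arbitrary: av v)
  case (Suc n)
  let ?adj = "\<lambda>x y. y \<in> set (nbs x)"
  have IH: "set (paths nbs n (remove1 x av) x) = {x # us |us. length us = n \<and> distinct us \<and>
      set us \<subseteq> set av - {x} \<and> successively ?adj (x # us)}" for x
    using Suc.IH[of "remove1 x av" x] Suc.prems by (simp add: distinct_remove1 set_remove1_eq)
  show ?case
  proof (intro equalityI subsetI)
    fix vs assume "vs \<in> set (paths nbs (Suc n) av v)"
    then obtain x us where "x \<in> set (nbs v)" "x \<in> set av" "vs = v # x # us" "length us = n" "distinct us"
        "set us \<subseteq> set av - {x}" "successively ?adj (x # us)"
      by (auto simp: IH)
    then show "vs \<in> {v # us |us. length us = Suc n \<and> distinct us \<and> set us \<subseteq> set av \<and> successively ?adj (v # us)}"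
      by (intro CollectI exI[of _ "x # us"]) auto
  next
    fix vs assume "vs \<in> {v # us |us. length us = Suc n \<and> distinct us \<and> set us \<subseteq> set av \<and> successively ?adj (v # us)}"
    then obtain x us where vs: "vs = v # x # us" "length us = n" "distinct (x # us)" "set (x # us) \<subseteq> set av"
        "successively ?adj (v # x # us)"
      by (auto simp: length_Suc_conv)
    then have "x # us \<in> set (paths nbs n (remove1 x av) x)" unfolding IH by auto
    then show "vs \<in> set (paths nbs (Suc n) av v)" using vs by auto
  qed
qed auto

lemma hd_paths: "us \<in> set (paths nbs n av v) \<Longrightarrow> hd us = v"
  by (cases n) auto

lemma distinct_concat_map_hd:
  assumes "distinct xs" "\<And>x. x \<in> set xs \<Longrightarrow> distinct (F x)"
    and "\<And>x us. x \<in> set xs \<Longrightarrow> us \<in> set (F x) \<Longrightarrow> g us = x"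
  shows "distinct (concat (map F xs))"
  using assms
proof (induction xs)
  case (Cons x xs)
  have "set (F x) \<inter> set (concat (map F xs)) = {}"
  proof -
    have False if "us \<in> set (F x)" "y \<in> set xs" "us \<in> set (F y)" for us y
      using Cons.prems(1) Cons.prems(3)[of x us] Cons.prems(3)[of y us] that by auto
    then show ?thesis by auto
  qed
  then show ?case using Cons by auto
qed simp

text \<open>The second vertex of a walk tells which recursive call produced it. Distinctness is what
  later turns a product over the set of cycles into a product over the list.\<close>

lemma distinct_paths:
  assumes "\<And>x. distinct (nbs x)"
  shows "distinct (paths nbs n av v)"
proof (induction n arbitrary: av v)
  case (Suc n)
  show ?case
    unfolding paths.simps
    by (rule distinct_concat_map_hd[where g = "\<lambda>us. hd (tl us)"])
       (auto simp: distinct_map Suc assms hd_paths)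
qed simp

section \<open>Cancellation in products of corner signs\<close>

fun toggle :: "'a \<Rightarrow> 'a list \<Rightarrow> 'a list" where
  "toggle x [] = [x]"
| "toggle x (y # ys) = (if x = y then ys else y # toggle x ys)"

text \<open>
  Reduces a product of corner signs modulo the rule that reversing a corner flips its sign: \<open>s\<close>
  is the parity of the number of reversals, and \<open>ts\<close> are the corners seen an odd number of times.
\<close>

fun tally :: "('a \<Rightarrow> nat) \<Rightarrow> ('a \<times> 'a \<times> 'a) list \<Rightarrow> bool \<Rightarrow> ('a \<times> 'a \<times> 'a) list \<Rightarrow> bool \<times> ('a \<times> 'a \<times> 'a) list" where
  "tally rk [] s ts = (s, ts)"
| "tally rk ((a, v, b) # xs) s ts =
     (if rk a < rk b then tally rk xs s (toggle (a, v, b) ts) else tally rk xs (\<not> s) (toggle (b, v, a) ts))"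

lemma prod_toggle:
  fixes F :: "'a \<Rightarrow> 'b::comm_ring_1"
  assumes "F x * F x = 1"
  shows "prod_list (map F (toggle x ys)) = F x * prod_list (map F ys)"
  using assms by (induction ys) (auto simp: mult.left_commute mult.assoc[symmetric])

text \<open>Each step preserves the signed product: an occurrence met a second time cancels because
  squares are 1, and a triple not in rank order is replaced by its reverse at the cost of a
  sign.\<close>

lemma prod_tally:
  fixes F :: "'a \<times> 'a \<times> 'a \<Rightarrow> 'b::comm_ring_1"
  assumes "tally rk xs s ts = (s', ts')"
    and "\<And>a v b. (a, v, b) \<in> set xs \<Longrightarrow> F (a, v, b) * F (a, v, b) = 1 \<and> F (b, v, a) = - F (a, v, b)"
  shows "(if s then -1 else 1) * (prod_list (map F xs) * prod_list (map F ts)) =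
         (if s' then -1 else 1) * prod_list (map F ts')"
  using assms
proof (induction rk xs s ts arbitrary: s' ts' rule: tally.induct)
  case (2 rk a v b xs s ts)
  have F: "F (a, v, b) * F (a, v, b) = 1" "F (b, v, a) = - F (a, v, b)" using 2(4) by auto
  then have F': "F (b, v, a) * F (b, v, a) = 1" by simp
  show ?case
  proof (cases "rk a < rk b")
    case True
    then have "(if s then -1 else 1) * (prod_list (map F xs) * prod_list (map F (toggle (a, v, b) ts))) =
        (if s' then -1 else 1) * prod_list (map F ts')"
      using 2(1)[OF True] 2(3,4) by auto
    then show ?thesis by (simp add: prod_toggle[of F "(a, v, b)", OF F(1)] algebra_simps)
  next
    case False
    then have "(if \<not> s then -1 else 1) * (prod_list (map F xs) * prod_list (map F (toggle (b, v, a) ts))) =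
        (if s' then -1 else 1) * prod_list (map F ts')"
      using 2(2)[OF False] 2(3,4) by auto
    then show ?thesis by (cases s) (simp_all add: prod_toggle[of F "(b, v, a)", OF F'] F(2) algebra_simps)
  qed
qed simp

section \<open>The product of parity signs over all cycles of a given length\<close>

context immersed_bipartite_graph
begin

text \<open>Whatever the start and direction of \<open>p\<close>, its corner product agrees with
  that of the canonical sequence, so the arbitrary orientation of the cycle no longer
  matters.\<close>

lemma sign_of_rotation_number:
  assumes C: "C \<subseteq> E" and p: "parametrizes p C" and k: "card C = k" "even k" and rk: "inj rk"
  obtains w where "canonical_seq rk k w" "seq_edges w = C"
    "(if even (rotation_number (f \<circ> p)) then 1 else -1) = (\<Prod>i<k. turn (w i) (w (Suc i)) (w (Suc (Suc i))))"
proof -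
  obtain v :: "nat \<Rightarrow> 'v" and k' where v': "3 \<le> k'" "\<And>i. v (i + k') = v i" "inj_on v {..<k'}"
    "C = (\<lambda>i. {v i, v (Suc i)}) ` {..<k'}" "card C = k'"
    "(if even (rotation_number (f \<circ> p)) then 1 else -1) = (\<Prod>i<k'. turn (v i) (v (Suc i)) (v (Suc (Suc i))))"
    by (rule rotation_number_turns[OF C p]) (rule that; assumption)
  have "k' = k" using v'(5) k(1) by simp
  note v = v'(1-4,6)[unfolded this]
  have v_mod: "v (i mod k) = v i" for i
  proof -
    have "v (j + m * k) = v j" for j m
      by (induction m) (simp_all add: add.assoc[symmetric] v(2) add.commute[of k])
    then show ?thesis by (metis mod_mult_div_eq add.commute mult.commute)
  qed
  have cv: "cyclic_seq k v"
    unfolding cyclic_seq_def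
  proof (intro allI iffI)
    fix i j
    show "i mod k = j mod k" if "v i = v j"
      using inj_onD[OF v(3), of "i mod k" "j mod k"] that v(1) by (simp add: v_mod)
    show "v i = v j" if "i mod k = j mod k" using that by (metis v_mod)
  qed
  have edges: "seq_edges v = C" using seq_edges_conv_period[OF cv] v(1,4) by simp
  have flip: "turn (v (Suc (Suc i))) (v (Suc i)) (v i) = - turn (v i) (v (Suc i)) (v (Suc (Suc i)))" for i
  proof (rule turn_reverse)
    show "{v i, v (Suc i)} \<in> E" "{v (Suc i), v (Suc (Suc i))} \<in> E"
      using edges C unfolding seq_edges_def by auto
    show "v i \<noteq> v (Suc (Suc i))"
    proof
      assume "v i = v (Suc (Suc i))"
      then have "(0 + i) mod k = (2 + i) mod k" using cyclic_seqD[OF cv, of i "Suc (Suc i)"] by simp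
      then have "0 mod k = 2 mod k" by (simp only: mod_add_cancel_nat)
      then show False using v(1) by simp
    qed
  qed
  obtain u where u: "canonical_seq rk k u" "seq_edges u = seq_edges v"
    "(\<Prod>i<k. turn (u i) (u (Suc i)) (u (Suc (Suc i)))) = (\<Prod>i<k. turn (v i) (v (Suc i)) (v (Suc (Suc i))))"
    by (rule canonical_seq_exists[where T = turn, OF cv v(1) k(2) rk flip])
  show ?thesis by (rule that[of u]) (use u v(1,5) edges in simp_all)
qed

text \<open>Canonical lists correspond bijectively to cycles. That every cycle is reached comes from
  its parametrization, which passes through the vertices in cyclic order.\<close>

lemma prod_signs_over_cycles:
  fixes p :: "'v set set \<Rightarrow> real \<Rightarrow> real ^ 'v"
  assumes p: "\<And>C. C \<in> cycles k E \<Longrightarrow> parametrizes (p C) C"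
    and k: "3 \<le> k" "even k" and rk: "inj rk"
  shows "(\<Prod>C\<in>cycles k E. if even (rotation_number (f \<circ> p C)) then 1 else -1) =
    (\<Prod>vs\<in>canonical_cycles (\<lambda>x y. {x, y} \<in> E) rk k.
       prod_list (map (\<lambda>(a, v, b). turn a v b) (cycle_triples vs)))"
proof -
  let ?X = "canonical_cycles (\<lambda>x y. {x, y} \<in> E) rk k"
  note X = canonical_cycles_iff_seq[OF k(1) rk refl, where E = E]
  have inj: "inj_on cycle_edges ?X"
  proof (rule inj_onI)
    fix us vs assume us: "us \<in> ?X" and vs: "vs \<in> ?X" and eq: "cycle_edges us = cycle_edges vs"
    obtain u where u: "us = map u [0..<k]" "canonical_seq rk k u" using iffD1[OF X us] by blast
    obtain v where v: "vs = map v [0..<k]" "canonical_seq rk k v" using iffD1[OF X vs] by blast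
    have "seq_edges u = seq_edges v"
      using eq list_of_cyclic_seq(2)[OF _ k(1)] u v by (auto simp: canonical_seq_def)
    then have "u = v" using canonical_seq_unique[OF u(2) v(2) k(1) rk] by blast
    then show "us = vs" using u v by simp
  qed
  have into: "cycle_edges vs \<in> cycles k E" if "vs \<in> ?X" for vs
  proof -
    obtain w where w: "vs = map w [0..<k]" "canonical_seq rk k w" "seq_edges w \<subseteq> E"
      using iffD1[OF X \<open>vs \<in> ?X\<close>] by blast
    have cw: "cyclic_seq k w" using w(2) by (simp add: canonical_seq_def)
    \<comment> \<open>Equal edges at different indices would be run through in opposite directions
      and force \<open>w (Suc (Suc j)) = w j\<close>, which \<open>3 \<le> k\<close>
      excludes.\<close>
    have "inj_on (\<lambda>i. {w i, w (Suc i)}) {..<k}"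
    proof (rule inj_onI)
      fix i j assume ij: "i \<in> {..<k}" "j \<in> {..<k}" "{w i, w (Suc i)} = {w j, w (Suc j)}"
      show "i = j"
      proof (rule ccontr)
        assume "i \<noteq> j"
        then have "w i \<noteq> w j" using ij cyclic_seqD[OF cw, of i j] by simp
        then have "w i = w (Suc j)" "w (Suc i) = w j" using ij(3) by (auto simp: doubleton_eq_iff)
        then have "w (Suc (Suc j)) = w j"
          using cyclic_seqD[OF cw] by (metis mod_Suc_eq)
        then have "(2 + j) mod k = (0 + j) mod k" using cyclic_seqD[OF cw, of "Suc (Suc j)" j] by simp
        then have "2 mod k = 0 mod k" by (simp only: mod_add_cancel_nat)
        then show False using k(1) by simp
      qed
    qed
    then have "card (seq_edges w) = k"
      using seq_edges_conv_period[OF cw] k(1) by (simp add: card_image)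
    then show ?thesis
      using realization_cycle_homeomorphic[of vs] list_of_cyclic_seq[OF cw k(1)] w k(1)
      by (simp add: cycles_def)
  qed
  have sign: "\<exists>vs\<in>?X. cycle_edges vs = C \<and> (if even (rotation_number (f \<circ> p C)) then 1 else -1) =
      prod_list (map (\<lambda>(a, v, b). turn a v b) (cycle_triples vs))" if "C \<in> cycles k E" for C
  proof -
    have C: "C \<subseteq> E" "card C = k" using that by (auto simp: cycles_def)
    have param: "parametrizes (p C) C" by (rule p[OF that])
    obtain w where w: "canonical_seq rk k w" "seq_edges w = C"
      "(if even (rotation_number (f \<circ> p C)) then 1 else -1) = (\<Prod>i<k. turn (w i) (w (Suc i)) (w (Suc (Suc i))))"
      by (rule sign_of_rotation_number[OF C(1) param C(2) k(2) rk]) (rule that)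
    have cw: "cyclic_seq k w" using w(1) by (simp add: canonical_seq_def)
    have "map w [0..<k] \<in> ?X" using w C(1) by (intro iffD2[OF X]) blast
    moreover have "prod_list (map (\<lambda>(a, v, b). turn a v b) (cycle_triples (map w [0..<k]))) =
        (\<Prod>i<k. turn (w i) (w (Suc i)) (w (Suc (Suc i))))"
      unfolding cycle_triples_seq[OF cw k(1)]
      by (simp add: comp_def lessThan_atLeast0 flip: prod.distinct_set_conv_list)
    ultimately show ?thesis using list_of_cyclic_seq(2)[OF cw k(1)] w by force
  qed
  have "bij_betw cycle_edges ?X (cycles k E)"
    unfolding bij_betw_def using inj into sign by blast
  then have "(\<Prod>C\<in>cycles k E. if even (rotation_number (f \<circ> p C)) then 1 else -1) =
      (\<Prod>vs\<in>?X. if even (rotation_number (f \<circ> p (cycle_edges vs))) then 1 else (-1 :: complex))"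
    by (rule prod.reindex_bij_betw[symmetric])
  also have "\<dots> = (\<Prod>vs\<in>?X. prod_list (map (\<lambda>(a, v, b). turn a v b) (cycle_triples vs)))"
  proof (rule prod.cong[OF refl])
    fix vs assume vs: "vs \<in> ?X"
    then obtain us where us: "us \<in> ?X" "cycle_edges us = cycle_edges vs"
      "(if even (rotation_number (f \<circ> p (cycle_edges vs))) then 1 else -1) =
      prod_list (map (\<lambda>(a, v, b). turn a v b) (cycle_triples us))"
      using sign[OF into] by blast
    then have "us = vs" using inj_onD[OF inj] vs by blast
    then show "(if even (rotation_number (f \<circ> p (cycle_edges vs))) then 1 else -1) =
      prod_list (map (\<lambda>(a, v, b). turn a v b) (cycle_triples vs))" using us(3) by simp
  qed
  finally show ?thesis .
qed

end

context immersed_bipartite_graph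
begin

text \<open>Supplies the two rules that \<open>prod_tally\<close> assumes of the signs.\<close>

lemma turn_at_cycle_corner:
  assumes vs: "vs \<in> canonical_cycles (\<lambda>x y. {x, y} \<in> E) rk k" and k: "3 \<le> k" and rk: "inj rk"
    and t: "(a, v, b) \<in> set (cycle_triples vs)"
  shows "turn a v b * turn a v b = 1" "turn b v a = - turn a v b"
proof -
  obtain w where w: "vs = map w [0..<k]" "canonical_seq rk k w" "seq_edges w \<subseteq> E"
    using iffD1[OF canonical_cycles_iff_seq[OF k rk refl, where E = E] vs] by blast
  have cw: "cyclic_seq k w" using w(2) by (simp add: canonical_seq_def)
  obtain i where i: "a = w i" "v = w (Suc i)" "b = w (Suc (Suc i))"
    using t unfolding w(1) cycle_triples_seq[OF cw k] by auto
  have ne: "a \<noteq> b"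
  proof
    assume "a = b"
    then have "(0 + i) mod k = (2 + i) mod k" using cyclic_seqD[OF cw, of i "Suc (Suc i)"] i by simp
    then have "0 mod k = 2 mod k" by (simp only: mod_add_cancel_nat)
    then show False using k by simp
  qed
  have "{a, v} \<in> E" "{v, b} \<in> E" using w(3) unfolding i seq_edges_def by auto
  then show "turn a v b * turn a v b = 1" "turn b v a = - turn a v b"
    using turn_sign turn_reverse ne by fastforce+
qed

end

text \<open>Lets the enumeration run on a plain datatype of labels with a table of neighbours, in
  place of vertices indexed by integers modulo 7.\<close>

lemma canonical_cycles_map:
  assumes h: "bij h" and adj: "\<And>x y. adj' (h x) (h y) \<longleftrightarrow> adj x y" and rk: "\<And>x. rk' (h x) = rk x"
    and k: "2 \<le> k"
  shows "canonical_cycles adj' rk' k = map h ` canonical_cycles adj rk k"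
proof -
  have iff: "map h vs \<in> canonical_cycles adj' rk' k \<longleftrightarrow> vs \<in> canonical_cycles adj rk k" for vs
  proof (cases "length vs = k")
    case True
    then have ne: "vs \<noteq> []" "1 < length vs" using k by auto
    have "inj_on h A" for A using h by (auto simp: bij_def intro: inj_on_subset)
    then show ?thesis
      using ne by (simp add: canonical_cycles_def distinct_map successively_map adj rk
          last_map hd_map flip: map_tl)
  qed (simp add: canonical_cycles_def)
  have "map h (map (inv h) us) = us" for us
    using surj_f_inv_f[OF bij_is_surj[OF h]] by (simp add: map_idI)
  then show ?thesis using iff by (metis (no_types, lifting) image_iff subsetI subset_antisym)
qed

section \<open>Enumeration for the Heawood graph\<close>

text \<open>Each \<open>v\<close> is tried as the vertex of least rank, so only vertices of larger
  rank are offered to the walk; the closing edge and the direction are tested at the end.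
  \<open>n\<close> counts steps of the walk, one less than the length of the cycle.\<close>

definition cycle_list :: "('a \<Rightarrow> 'a list) \<Rightarrow> ('a \<Rightarrow> nat) \<Rightarrow> 'a list \<Rightarrow> nat \<Rightarrow> 'a list list" where
  "cycle_list nbs rk xs n =
     concat (map (\<lambda>v. filter (\<lambda>vs. hd vs \<in> set (nbs (last vs)) \<and> rk (vs ! 1) < rk (last vs))
       (paths nbs n (filter (\<lambda>x. rk v < rk x) xs) v)) xs)"

lemma set_cycle_list:
  assumes "distinct xs" "set xs = UNIV"
  shows "set (cycle_list nbs rk xs n) = canonical_cycles (\<lambda>x y. y \<in> set (nbs x)) rk (Suc n)"
    (is "?L = ?R")
proof (intro equalityI subsetI)
  fix vs assume "vs \<in> ?L"
  then show "vs \<in> ?R"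
    using assms by (auto simp: cycle_list_def set_paths canonical_cycles_def)
next
  fix vs assume vs: "vs \<in> ?R"
  then obtain v us where "vs = v # us" by (cases vs) (auto simp: canonical_cycles_def)
  then show "vs \<in> ?L"
    using vs assms by (auto simp: cycle_list_def set_paths canonical_cycles_def)
qed

lemma distinct_cycle_list:
  assumes "distinct xs" "\<And>x. distinct (nbs x)"
  shows "distinct (cycle_list nbs rk xs n)"
  unfolding cycle_list_def
  by (rule distinct_concat_map_hd[where g = hd]) (auto simp: assms distinct_paths hd_paths)

lemma prod_list_concat_map:
  "prod_list (map F (concat xss)) = prod_list (map (\<lambda>xs. prod_list (map F xs)) xss)"
  by (induction xss) auto

datatype label = U0 | U1 | U2 | U3 | U4 | U5 | U6 | V0 | V1 | V2 | V3 | V4 | V5 | V6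

definition labels :: "label list" where
  "labels = [U0, U1, U2, U3, U4, U5, U6, V0, V1, V2, V3, V4, V5, V6]"

primrec vertex :: "label \<Rightarrow> heawood_vertex" where
  "vertex U0 = HU 0" | "vertex U1 = HU 1" | "vertex U2 = HU 2" | "vertex U3 = HU 3"
| "vertex U4 = HU 4" | "vertex U5 = HU 5" | "vertex U6 = HU 6"
| "vertex V0 = HV 0" | "vertex V1 = HV 1" | "vertex V2 = HV 2" | "vertex V3 = HV 3"
| "vertex V4 = HV 4" | "vertex V5 = HV 5" | "vertex V6 = HV 6"

text \<open>With indices modulo 7, the neighbours of \<open>u_i\<close> are \<open>v_i\<close>,
  \<open>v_(i-1)\<close>, \<open>v_(i+2)\<close>, and those of \<open>v_i\<close> are
  \<open>u_i\<close>, \<open>u_(i+1)\<close>, \<open>u_(i-2)\<close>. The table is checked against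
  the edge set in \<open>vertex_adjacent\<close>.\<close>

primrec nbs :: "label \<Rightarrow> label list" where
  "nbs U0 = [V0, V6, V2]" | "nbs U1 = [V1, V0, V3]" | "nbs U2 = [V2, V1, V4]" | "nbs U3 = [V3, V2, V5]"
| "nbs U4 = [V4, V3, V6]" | "nbs U5 = [V5, V4, V0]" | "nbs U6 = [V6, V5, V1]"
| "nbs V0 = [U0, U1, U5]" | "nbs V1 = [U1, U2, U6]" | "nbs V2 = [U2, U3, U0]" | "nbs V3 = [U3, U4, U1]"
| "nbs V4 = [U4, U5, U2]" | "nbs V5 = [U5, U6, U3]" | "nbs V6 = [U6, U0, U4]"

primrec idx :: "label \<Rightarrow> nat" where
  "idx U0 = 0" | "idx U1 = 1" | "idx U2 = 2" | "idx U3 = 3" | "idx U4 = 4" | "idx U5 = 5" | "idx U6 = 6"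
| "idx V0 = 7" | "idx V1 = 8" | "idx V2 = 9" | "idx V3 = 10" | "idx V4 = 11" | "idx V5 = 12" | "idx V6 = 13"

lemma labels: "distinct labels" "set labels = UNIV"
proof -
  show "distinct labels" by (simp add: labels_def)
  have "x \<in> set labels" for x by (cases x) (simp_all add: labels_def)
  then show "set labels = UNIV" by blast
qed

lemma inj_idx: "inj idx"
proof (rule injI)
  fix x y assume "idx x = idx y" then show "x = y" by (cases x; cases y) simp_all
qed

lemma distinct_nbs: "distinct (nbs x)"
  by (cases x) simp_all

text \<open>The edges \<open>{HV i, HU (i - 2)}\<close> are reindexed by \<open>i + 2\<close>, so
  that all three neighbours of \<open>HU i\<close> are expressed through \<open>i\<close>.\<close>

lemma heawood_adjacent:
  "{HU i, HV j} \<in> heawood_edges \<longleftrightarrow> j = i \<or> j = i - 1 \<or> j = i + 2"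
  "{HV j, HU i} \<in> heawood_edges \<longleftrightarrow> j = i \<or> j = i - 1 \<or> j = i + 2"
  "{HU i, HU i'} \<notin> heawood_edges" "{HV j, HV j'} \<notin> heawood_edges"
proof -
  have "{HV (i + 2), HU (i + 2 - 2)} \<in> heawood_edges" unfolding heawood_edges_def by blast
  then have "{HU i, HV (i + 2)} \<in> heawood_edges" by (simp add: insert_commute)
  then show 1: "{HU i, HV j} \<in> heawood_edges \<longleftrightarrow> j = i \<or> j = i - 1 \<or> j = i + 2"
    by (auto simp: heawood_edges_def doubleton_eq_iff)
  then show "{HV j, HU i} \<in> heawood_edges \<longleftrightarrow> j = i \<or> j = i - 1 \<or> j = i + 2"
    by (simp add: insert_commute)
qed (auto simp: heawood_edges_def doubleton_eq_iff)

lemma exhaust_7: "(i :: 7) \<in> {0, 1, 2, 3, 4, 5, 6}"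
proof -
  obtain n where "i = of_int n" "0 \<le> n" "n < 7" by (cases i) auto
  then have "n \<in> {0, 1, 2, 3, 4, 5, 6}" by auto
  then show ?thesis using \<open>i = of_int n\<close> by auto
qed

lemma bij_vertex: "bij vertex"
proof (rule bijI)
  show "inj vertex"
  proof (rule injI)
    fix x y assume "vertex x = vertex y" then show "x = y" by (cases x; cases y) simp_all
  qed
  show "surj vertex"
  proof -
    have "y \<in> range vertex" for y
    proof (cases y)
      case (HU i)
      have "HU i \<in> vertex ` {U0, U1, U2, U3, U4, U5, U6}" using exhaust_7[of i] by auto
      then show ?thesis unfolding HU by blast
    next
      case (HV i)
      have "HV i \<in> vertex ` {V0, V1, V2, V3, V4, V5, V6}" using exhaust_7[of i] by auto
      then show ?thesis unfolding HV by blast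
    qed
    then show ?thesis by blast
  qed
qed

lemma card_heawood_edge: "e \<in> heawood_edges \<Longrightarrow> card e = 2"
  by (auto simp: heawood_edges_def)

lemma vertex_adjacent: "{vertex x, vertex y} \<in> heawood_edges \<longleftrightarrow> y \<in> set (nbs x)"
proof -
  \<comment> \<open>For \<open>x = y\<close> the pair collapses to a singleton, which is not an
    edge; the rest is a finite check.\<close>
  have "{z} \<notin> heawood_edges" for z using card_heawood_edge[of "{z}"] by auto
  then show ?thesis by (cases x; cases y) (simp_all add: heawood_adjacent)
qed

lemma sign_sum:
  "finite A \<Longrightarrow> (\<Prod>x\<in>A. if even (r x :: int) then 1 else -1) = (if even (\<Sum>x\<in>A. r x) then 1 else (-1 :: complex))"
  by (induction A rule: finite_induct) auto

text \<open>The arguments 5, 7, 9, 11, 13 are the cycle lengths minus 1. The empty list records that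
  every corner, up to reversal, occurs an even number of times, so all unknown signs cancel; the
  Boolean is the parity of the number of corners met against the rank order.\<close>

lemma tallies:
  "tally idx (concat (map cycle_triples (cycle_list nbs idx labels 5))) False [] = (True, [])"
  "tally idx (concat (map cycle_triples (cycle_list nbs idx labels 7))) False [] = (False, [])"
  "tally idx (concat (map cycle_triples (cycle_list nbs idx labels 9))) False [] = (True, [])"
  "tally idx (concat (map cycle_triples (cycle_list nbs idx labels 11))) False [] = (False, [])"
  "tally idx (concat (map cycle_triples (cycle_list nbs idx labels 13))) False [] = (False, [])"
  by code_simp+

text \<open>With no unknown sign left over, the product of the parity signs over all cycles is -1 or
  1 according to \<open>s\<close>; the same product is the parity sign of the sum.\<close>

lemma sum_rotation_numbers_parity:
  fixes f :: "real ^ heawood_vertex \<Rightarrow> complex"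
    and p :: "heawood_vertex set set \<Rightarrow> real \<Rightarrow> real ^ heawood_vertex"
  assumes f: "plane_immersion heawood_edges f"
    and p: "\<And>k \<gamma>. \<gamma> \<in> cycles k heawood_edges \<Longrightarrow> parametrizes (p \<gamma>) \<gamma>"
    and n: "2 \<le> n" "odd n"
    and tally: "tally idx (concat (map cycle_triples (cycle_list nbs idx labels n))) False [] = (s, [])"
  shows "odd (\<Sum>\<gamma>\<in>cycles (Suc n) heawood_edges. rotation_number (f \<circ> p \<gamma>)) \<longleftrightarrow> s"
proof -
  let ?E = heawood_edges and ?k = "Suc n" and ?L = "cycle_list nbs idx labels n"
  define rk where "rk = idx \<circ> inv vertex"
  have rk_vertex: "rk (vertex x) = idx x" for x
    using bij_vertex by (simp add: rk_def bij_is_inj inv_f_f)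
  have inj_rk: "inj rk"
    using inj_compose[OF inj_idx bij_is_inj[OF bij_imp_bij_inv[OF bij_vertex]]] by (simp add: rk_def)
  obtain \<eta> where \<eta>: "0 < \<eta>"
      "\<And>x y. x \<in> realization ?E \<Longrightarrow> y \<in> realization ?E \<Longrightarrow> x \<noteq> y \<Longrightarrow> dist x y < \<eta> \<Longrightarrow> f x \<noteq> f y"
    using uniform_local_injectivity[OF compact_realization, of ?E f] f
    unfolding plane_immersion_def by metis
  \<comment> \<open>With \<open>\<mu> = \<eta> / 4\<close>, points at distance at most
    \<open>2 * \<mu>\<close> are closer than \<open>\<eta>\<close>.\<close>
  interpret immersed_bipartite_graph ?E f "\<lambda>x. x \<in> range HU" "\<eta> / 4"
  proof
    show "(a \<in> range HU) \<noteq> (b \<in> range HU)" if "{a, b} \<in> ?E" for a b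
      using that by (cases a; cases b) (auto simp: heawood_adjacent)
  qed (use \<eta> f card_heawood_edge in \<open>auto simp: plane_immersion_def\<close>)
  define T where "T = (\<lambda>(a, v, b). turn a v b)"
  define F where "F = (\<lambda>(a, v, b). T (vertex a, vertex v, vertex b))"
  have F: "F = T \<circ> map_prod vertex (map_prod vertex vertex)" by (auto simp: F_def)
  have canon: "canonical_cycles (\<lambda>x y. {x, y} \<in> ?E) rk ?k = map vertex ` set ?L"
    unfolding set_cycle_list[OF labels]
    by (rule canonical_cycles_map) (use bij_vertex vertex_adjacent rk_vertex n in simp_all)
  have "(if even (\<Sum>\<gamma>\<in>cycles ?k ?E. rotation_number (f \<circ> p \<gamma>)) then 1 else -1) =
      (\<Prod>\<gamma>\<in>cycles ?k ?E. if even (rotation_number (f \<circ> p \<gamma>)) then 1 else (-1 :: complex))"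
    by (rule sign_sum[symmetric]) simp
  also have "\<dots> = (\<Prod>vs\<in>map vertex ` set ?L. prod_list (map T (cycle_triples vs)))"
    unfolding canon[symmetric] T_def
    by (rule prod_signs_over_cycles[OF p _ _ inj_rk]) (use n in auto)
  also have "\<dots> = (\<Prod>vs\<in>set ?L. prod_list (map F (cycle_triples vs)))"
    by (subst prod.reindex)
       (use bij_vertex in \<open>auto simp: F cycle_triples_map bij_is_inj intro: inj_on_subset[of _ UNIV]\<close>)
  also have "\<dots> = prod_list (map F (concat (map cycle_triples ?L)))"
    by (simp add: prod.distinct_set_conv_list distinct_cycle_list labels distinct_nbs prod_list_concat_map comp_def)
  also have "\<dots> = (if s then -1 else 1)"
  proof -
    have "F (a, v, b) * F (a, v, b) = 1 \<and> F (b, v, a) = - F (a, v, b)"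
      if abv: "(a, v, b) \<in> set (concat (map cycle_triples ?L))" for a v b
    proof -
      obtain vs where vs: "vs \<in> set ?L" "(a, v, b) \<in> set (cycle_triples vs)" using abv by auto
      have "map vertex vs \<in> canonical_cycles (\<lambda>x y. {x, y} \<in> ?E) rk ?k" using vs canon by blast
      moreover have "(vertex a, vertex v, vertex b) \<in> set (cycle_triples (map vertex vs))"
        using vs(2) unfolding cycle_triples_map by force
      ultimately show ?thesis
        using turn_at_cycle_corner[OF _ _ inj_rk] n by (simp add: F_def T_def)
    qed
    from prod_tally[OF tally, of F, OF this] show ?thesis by simp
  qed
  finally show ?thesis by (auto split: if_splits)
qed

lemma cong_2_iff_parity: "[a = b] (mod 2) \<longleftrightarrow> (even a \<longleftrightarrow> even b)" for a b :: int
  unfolding cong_def by presburger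

theorem corollary1p14:
  fixes f :: "real ^ heawood_vertex \<Rightarrow> complex"
    and p :: "heawood_vertex set set \<Rightarrow> real \<Rightarrow> real ^ heawood_vertex"
  assumes "plane_generic_immersion heawood_edges f"
    and "\<And>k \<gamma>. \<gamma> \<in> cycles k heawood_edges \<Longrightarrow> parametrizes (p \<gamma>) \<gamma>"
  shows "[(\<Sum>\<gamma>\<in>cycles 6 heawood_edges. rotation_number (f \<circ> p \<gamma>)) =
          (\<Sum>\<gamma>\<in>cycles 10 heawood_edges. rotation_number (f \<circ> p \<gamma>))] (mod 2) \<and>
         [(\<Sum>\<gamma>\<in>cycles 10 heawood_edges. rotation_number (f \<circ> p \<gamma>)) = 1] (mod 2) \<and>
         [(\<Sum>\<gamma>\<in>cycles 8 heawood_edges. rotation_number (f \<circ> p \<gamma>)) =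
          (\<Sum>\<gamma>\<in>cycles 12 heawood_edges. rotation_number (f \<circ> p \<gamma>))] (mod 2) \<and>
         [(\<Sum>\<gamma>\<in>cycles 12 heawood_edges. rotation_number (f \<circ> p \<gamma>)) =
          (\<Sum>\<gamma>\<in>cycles 14 heawood_edges. rotation_number (f \<circ> p \<gamma>))] (mod 2) \<and>
         [(\<Sum>\<gamma>\<in>cycles 14 heawood_edges. rotation_number (f \<circ> p \<gamma>)) = 0] (mod 2)"
proof -
  have imm: "plane_immersion heawood_edges f"
    using assms(1) by (simp add: plane_generic_immersion_def)
  have parity: "odd (\<Sum>\<gamma>\<in>cycles (Suc n) heawood_edges. rotation_number (f \<circ> p \<gamma>)) \<longleftrightarrow> s"
    if "2 \<le> n" "odd n"
      "tally idx (concat (map cycle_triples (cycle_list nbs idx labels n))) False [] = (s, [])" for n s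
    using sum_rotation_numbers_parity[OF imm _ that] assms(2) by blast
  \<comment> \<open>Modulo 2 the chained congruences only compare parities; the sums for lengths 6,
    8, 10, 12, 14 are odd, even, odd, even, even.\<close>
  show ?thesis
    using parity[OF _ _ tallies(1)] parity[OF _ _ tallies(2)] parity[OF _ _ tallies(3)]
      parity[OF _ _ tallies(4)] parity[OF _ _ tallies(5)]
    unfolding cong_2_iff_parity by simp
qed

end
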